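(* The regularized magneto-quasistatic system $$\tfrac{\rm d}{{\rm d}t}\mathcal{E}_r x_r=\mathcal{A}_r(x_r)\,x_r+\mathcal{B}_r u,\qquad y_r=-\tfrac{\rm d}{{\rm d}t}\mathcal{B}_r^T x_r+R^{-1}u,$$ with state $x_r=[a_1^T,\,a_{21}^T]^T\in\mathbb{R}^{n_r}$, input $u$, output $y_r$ and $$\mathcal{E}_r=\begin{bmatrix} M_{11}+X_1R^{-1}X_1^T & X_1R^{-1}X_2^T\hat{Y}_{C_2}\\ \hat{Y}_{C_2}^TX_2R^{-1}X_1^T & \hat{Y}_{C_2}^TX_2R^{-1}X_2^T\hat{Y}_{C_2}\end{bmatrix},\quad \mathcal{A}_r(x_r)=-\begin{bmatrix} K_{11}(a_1) & K_{12}\hat{Y}_{C_2}\\ \hat{Y}_{C_2}^TK_{21} & \hat{Y}_{C_2}^TK_{22}\hat{Y}_{C_2}\end{bmatrix},\quad \mathcal{B}_r=\begin{bmatrix} X_1\\ \hat{Y}_{C_2}^TX_2\end{bmatrix}R^{-1},$$ is passive.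
   Context: All spaces are real; $\|\cdot\|$ is the Euclidean norm. Domain and data. $\Omega\subset\mathbb{R}^3$ is a simply connected bounded Lipschitz domain, decomposed into a conducting subdomain $\Omega_C$ (connected, $\overline{\Omega}_C\subset\Omega$) and a non-conducting subdomain $\Omega_I=\Omega\setminus\overline{\Omega}_C$; $\Omega_I$ has finitely many connected internal subdomains with single boundary components $\Gamma_1,\ldots,\Gamma_q$ and an external subdomain $\Omega_{I,\rm ext}$ with two boundary components $\Gamma_{\rm ext}=\overline{\Omega}_{I,\rm ext}\cap\overline{\Omega}_C$ and $\partial\Omega$. The conductivity is $\sigma=\sigma_C\mathbb{1}_{\Omega_C}$ with $\sigma_C>0$. The reluctivity is $\nu(\xi,\zeta)=\nu_C(\zeta)\mathbb{1}_{\Omega_C}(\xi)+\nu_I\mathbb{1}_{\Omega_I}(\xi)$, where $\nu_I>0$ and $\nu_C:\mathbb{R}_{\ge0}\to\mathbb{R}_{\ge0}$ is measurable, and $\zeta\mapsto\nu_C(\zeta)\zeta$ is strongly monotone with constant $m_{\nu_C}>0$ and Lipschitz continuous with constant $L_{\nu_C}>0$. The resistance matrix $R\in\mathbb{R}^{m\times m}$ is symmetric positive definite. The winding function $\chi=[\chi_1,\ldots,\chi_m]$ has columns $\chi_j\in L^2(\Omega;\mathbb{R}^3)$ with $\nabla\cdot\chi_j=0$ and pairwise disjoint supports; $\gamma_j$ are functions with components in $H^1(\Omega)$ and $\chi_j=\nabla\times\gamma_j$. FEM matrices. $\varphi_1^e,\ldots,\varphi_{n_e}^e\in H_0(\mathrm{curl},\Omega)$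 are the edge (Nédélec, first type) basis functions and $\varphi_1^f,\ldots,\varphi_{n_f}^f$ the face basis functions of a regular simplicial triangulation of $\Omega$. $C_d\in\mathbb{R}^{n_f\times n_e}$ is the discrete curl matrix, with $(C_d)_{kj}=\pm1$ if edge $j$ belongs to face $k$ with the same/opposite orientation, and $0$ otherwise. For $a=[\alpha_1^e,\ldots,\alpha_{n_e}^e]^T$ put $(M_\sigma)_{kl}=\int_\Omega\sigma\,\varphi_l^e\cdot\varphi_k^e\,{\rm d}\xi$, $(K(a))_{kl}=\int_\Omega\nu(\xi,\|\nabla\times\sum_j\alpha_j^e\varphi_j^e\|)(\nabla\times\varphi_l^e)\cdot(\nabla\times\varphi_k^e)\,{\rm d}\xi$, $X_{kj}=\int_\Omega\chi_j\cdot\varphi_k^e\,{\rm d}\xi$. They factor as $K(a)=C_d^TM_\nu(C_d\,a)C_d$ and $X=C_d^T\Upsilon$, where, with $C_d\,a=[\alpha_1^f,\ldots,\alpha_{n_f}^f]^T$, $(M_\nu(C_d\,a))_{kl}=\int_\Omega\nu(\xi,\|\sum_j\alpha_j^f\varphi_j^f\|)\varphi_l^f\cdot\varphi_k^f\,{\rm d}\xi$ and $\Upsilon_{kj}=\int_\Omega\gamma_j\cdot\varphi_k^f\,{\rm d}\xi$; $M_\nu(C_d\,a)$ is symmetric positive definite for all $a$. Ordering the edge basis functions according to the conducting and non-conducting subdomains gives partitions $a=[a_1^T,a_2^T]^T$ with $a_1\in\mathbb{R}^{n_1}$, $a_2\in\mathbb{R}^{n_2}$, $n_e=n_1+n_2$,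 $C_d=[C_1\ C_2]$, and $$M_\sigma=\begin{bmatrix}M_{11}&0\\ 0&0\end{bmatrix},\quad K(a)=\begin{bmatrix}K_{11}(a_1)&K_{12}\\ K_{21}&K_{22}\end{bmatrix},\quad X=\begin{bmatrix}X_1\\ X_2\end{bmatrix}=\begin{bmatrix}C_1^T\Upsilon\\ C_2^T\Upsilon\end{bmatrix},$$ where only $K_{11}(a_1)$ depends on $a$ (through $a_1$), $K_{12}$, $K_{21}=K_{12}^T$, $K_{22}$ are constant, $M_{11}$ is symmetric positive definite, and $X_2\in\mathbb{R}^{n_2\times m}$ has full column rank. Let $k_2=\dim\ker(C_2)$; the columns of $\hat{Y}_{C_2}\in\mathbb{R}^{n_2\times(n_2-k_2)}$ form a basis of $\mathrm{im}(C_2^T)$, and $n_r=n_1+n_2-k_2$. The initial condition is $\mathcal{F}_\sigma^Tx_r(0)=\mathcal{F}_\sigma^Tx_{r,0}$ with $\mathcal{F}_\sigma=\begin{bmatrix}I_{n_1}&X_1\\ 0&\hat{Y}_{C_2}^TX_2\end{bmatrix}$ (equivalently $\mathcal{E}_rx_r(0)=\mathcal{E}_rx_{r,0}$). Passivity. For a control system $\tfrac{\rm d}{{\rm d}t}Ex=A(x)+Bu$, $Ex(0)=Ex_0$, with output $y$, state space $\mathcal{X}=\mathbb{R}^n$ and input/output space $\mathbb{R}^m$, an input $u\in L^2([0,T];\mathbb{R}^m)$ is admissible with the initial condition $Ex(0)=Ex_0$ if the initial value problem has a solution $x:[0,T]\to\mathcal{X}$ such that the state equation holds in the sense of weak derivatives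 (in particular, $x$ is continuous) and $y\in L^2([0,T];\mathbb{R}^m)$. A function $\mathcal{S}:\mathcal{X}\to\mathbb{R}_{\ge0}\cup\{\infty\}$ is a storage function for passivity if for all $T>0$, all $x_0\in\mathcal{X}$ with $\mathcal{S}(x_0)<\infty$ and all inputs $u\in L^2([0,T];\mathbb{R}^m)$ admissible with $Ex(0)=Ex_0$: (a) $t\mapsto\mathcal{S}(x(t))$ is continuous from $[0,T]$ to $\mathbb{R}_{\ge0}\cup\{\infty\}$; (b) for all $0\le t_0\le t_1\le T$, $\mathcal{S}(x(t_1))-\mathcal{S}(x(t_0))\le\int_{t_0}^{t_1}u(\tau)^Ty(\tau)\,{\rm d}\tau$. The system is passive if there exists a storage function for passivity. *)

theory Defs
  imports "HOL-Analysis.Analysis"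
begin

section \<open>Function spaces and weak derivatives\<close>

definition L2_on :: "'a::euclidean_space set \<Rightarrow> ('a \<Rightarrow> 'b::euclidean_space) \<Rightarrow> bool" where
  "L2_on S f \<longleftrightarrow> f \<in> borel_measurable (lebesgue_on S)
     \<and> integrable (lebesgue_on S) (\<lambda>x. (norm (f x))\<^sup>2)"

definition loc_integrable_on :: "'a::euclidean_space set \<Rightarrow> ('a \<Rightarrow> 'b::euclidean_space) \<Rightarrow> bool" where
  "loc_integrable_on S f \<longleftrightarrow> (\<forall>K. compact K \<and> K \<subseteq> S \<longrightarrow> integrable (lebesgue_on K) f)"

definition partial :: "'a::euclidean_space \<Rightarrow> ('a \<Rightarrow> 'b::euclidean_space) \<Rightarrow> 'a \<Rightarrow> 'b" where
  "partial b f x = frechet_derivative f (at x) b"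

text \<open>Infinitely differentiable real-valued functions: the greatest class of everywhere
  differentiable functions that is closed under partial derivatives.\<close>

coinductive smooth :: "('a::euclidean_space \<Rightarrow> real) \<Rightarrow> bool" where
  "(\<forall>x. f differentiable at x) \<Longrightarrow> (\<forall>b\<in>Basis. smooth (partial b f)) \<Longrightarrow> smooth f"

definition test_function :: "'a::euclidean_space set \<Rightarrow> ('a \<Rightarrow> real) \<Rightarrow> bool" where
  "test_function S \<psi> \<longleftrightarrow> smooth \<psi> \<and> compact (closure {x. \<psi> x \<noteq> 0}) \<and> closure {x. \<psi> x \<noteq> 0} \<subseteq> S"

text \<open>\<open>g\<close> is the weak derivative of \<open>f\<close> in the coordinate direction \<open>b\<close> on the open set \<open>S\<close>.
  For \<open>S = {0<..<T}\<close> and \<open>b = 1\<close> this is the weak time derivative.\<close>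

definition weak_partial ::
    "'a::euclidean_space set \<Rightarrow> 'a \<Rightarrow> ('a \<Rightarrow> 'b::euclidean_space) \<Rightarrow> ('a \<Rightarrow> 'b) \<Rightarrow> bool" where
  "weak_partial S b f g \<longleftrightarrow> loc_integrable_on S f \<and> loc_integrable_on S g
     \<and> (\<forall>\<psi>. test_function S \<psi> \<longrightarrow>
          (\<integral>x. partial b \<psi> x *\<^sub>R f x \<partial>lebesgue_on S) = - (\<integral>x. \<psi> x *\<^sub>R g x \<partial>lebesgue_on S))"

definition weak_time_derivative ::
    "real \<Rightarrow> (real \<Rightarrow> 'b::euclidean_space) \<Rightarrow> (real \<Rightarrow> 'b) \<Rightarrow> bool" where
  "weak_time_derivative T f g \<longleftrightarrow> weak_partial {0<..<T} 1 f g"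

definition weakly_div_free :: "(real^3) set \<Rightarrow> (real^3 \<Rightarrow> real^3) \<Rightarrow> bool" where
  "weakly_div_free \<Omega> F \<longleftrightarrow> loc_integrable_on \<Omega> F
     \<and> (\<forall>\<psi>. test_function \<Omega> \<psi> \<longrightarrow>
          (\<integral>x. (\<Sum>b\<in>Basis. partial b \<psi> x * (F x \<bullet> b)) \<partial>lebesgue_on \<Omega>) = 0)"

text \<open>\<open>\<gamma>\<close> has components in \<open>H\<^sup>1(\<Omega>)\<close>, and \<open>F = \<nabla> \<times> \<gamma>\<close> almost everywhere; the curl is written
  as the sum of the \<open>e\<^sub>i \<times> \<partial>\<^sub>i \<gamma>\<close>.\<close>

definition H1_curl_potential ::
    "(real^3) set \<Rightarrow> (real^3 \<Rightarrow> real^3) \<Rightarrow> (real^3 \<Rightarrow> real^3) \<Rightarrow> bool" where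
  "H1_curl_potential \<Omega> \<gamma> F \<longleftrightarrow> L2_on \<Omega> \<gamma>
     \<and> (\<exists>D. (\<forall>b\<in>Basis. weak_partial \<Omega> b \<gamma> (D b) \<and> L2_on \<Omega> (D b))
          \<and> (AE x in lebesgue_on \<Omega>. F x = (\<Sum>b\<in>Basis. cross3 b (D b x))))"

text \<open>The curl at a point of differentiability. It is used for piecewise affine fields on a
  triangulation, which belong to \<open>H(curl)\<close>; their weak curl agrees with this one in the interior
  of every element, hence almost everywhere.\<close>

definition curl :: "(real^3 \<Rightarrow> real^3) \<Rightarrow> real^3 \<Rightarrow> real^3" where
  "curl F x = (\<Sum>b\<in>Basis. cross3 b (partial b F x))"

text \<open>Support, relative to \<open>\<Omega>\<close>, of a function that is defined up to null sets.\<close>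

definition ess_support :: "'a::euclidean_space set \<Rightarrow> ('a \<Rightarrow> 'b::euclidean_space) \<Rightarrow> 'a set" where
  "ess_support \<Omega> f = {x\<in>\<Omega>. \<forall>r>0. \<not> (AE z in lebesgue_on (\<Omega> \<inter> ball x r). f z = 0)}"


section \<open>Domain and material data\<close>

text \<open>Locally, after a rotation, \<open>\<Omega>\<close> is the strict epigraph of a Lipschitz function defined on
  the hyperplane orthogonal to \<open>n\<close>.\<close>

definition Lipschitz_boundary :: "'a::euclidean_space set \<Rightarrow> bool" where
  "Lipschitz_boundary \<Omega> \<longleftrightarrow>
     (\<forall>p\<in>frontier \<Omega>. \<exists>U n g L. open U \<and> p \<in> U \<and> norm n = 1
        \<and> L-lipschitz_on {z. n \<bullet> z = 0} (g :: 'a \<Rightarrow> real)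
        \<and> \<Omega> \<inter> U = {x\<in>U. g (x - (n \<bullet> x) *\<^sub>R n) < n \<bullet> x})"

definition bounded_Lipschitz_domain :: "'a::euclidean_space set \<Rightarrow> bool" where
  "bounded_Lipschitz_domain \<Omega> \<longleftrightarrow>
     open \<Omega> \<and> connected \<Omega> \<and> \<Omega> \<noteq> {} \<and> bounded \<Omega> \<and> Lipschitz_boundary \<Omega>"

definition nonconducting :: "'a::euclidean_space set \<Rightarrow> 'a set \<Rightarrow> 'a set" where
  "nonconducting \<Omega> \<Omega>C = \<Omega> - closure \<Omega>C"

text \<open>The internal subdomains are the connected components of the non-conducting region other
  than the external one.\<close>

definition mqs_domain :: "(real^3) set \<Rightarrow> (real^3) set \<Rightarrow> bool" where
  "mqs_domain \<Omega> \<Omega>C \<longleftrightarrow>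
     bounded_Lipschitz_domain \<Omega> \<and> simply_connected \<Omega>
     \<and> open \<Omega>C \<and> \<Omega>C \<noteq> {} \<and> connected \<Omega>C \<and> closure \<Omega>C \<subseteq> \<Omega>
     \<and> finite (components (nonconducting \<Omega> \<Omega>C))
     \<and> (\<exists>\<Omega>ext\<in>components (nonconducting \<Omega> \<Omega>C).
          components (frontier \<Omega>ext) = {closure \<Omega>ext \<inter> closure \<Omega>C, frontier \<Omega>}
          \<and> closure \<Omega>ext \<inter> closure \<Omega>C \<noteq> frontier \<Omega>
          \<and> (\<forall>D\<in>components (nonconducting \<Omega> \<Omega>C) - {\<Omega>ext}. connected (frontier D)))"

definition conductivity :: "(real^3) set \<Rightarrow> real \<Rightarrow> real^3 \<Rightarrow> real" where
  "conductivity \<Omega>C \<sigma>C \<xi> = \<sigma>C * indicator \<Omega>C \<xi>"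

definition reluctivity ::
    "(real^3) set \<Rightarrow> (real^3) set \<Rightarrow> (real \<Rightarrow> real) \<Rightarrow> real \<Rightarrow> real^3 \<Rightarrow> real \<Rightarrow> real" where
  "reluctivity \<Omega> \<Omega>C \<nu>C \<nu>I \<xi> \<zeta> =
     \<nu>C \<zeta> * indicator \<Omega>C \<xi> + \<nu>I * indicator (nonconducting \<Omega> \<Omega>C) \<xi>"

definition admissible_reluctivity :: "(real \<Rightarrow> real) \<Rightarrow> real \<Rightarrow> real \<Rightarrow> bool" where
  "admissible_reluctivity \<nu>C m L \<longleftrightarrow>
     \<nu>C \<in> borel_measurable (lebesgue_on {0..}) \<and> (\<forall>\<zeta>\<ge>0. \<nu>C \<zeta> \<ge> 0)
     \<and> m > 0 \<and> (\<forall>\<zeta>\<ge>0. \<forall>\<eta>\<ge>0. (\<nu>C \<zeta> * \<zeta> - \<nu>C \<eta> * \<eta>) * (\<zeta> - \<eta>) \<ge> m * (\<zeta> - \<eta>)\<^sup>2)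
     \<and> L > 0 \<and> L-lipschitz_on {0..} (\<lambda>\<zeta>. \<nu>C \<zeta> * \<zeta>)"

definition winding_functions :: "(real^3) set \<Rightarrow> ('m \<Rightarrow> real^3 \<Rightarrow> real^3) \<Rightarrow> bool" where
  "winding_functions \<Omega> chi \<longleftrightarrow>
     (\<forall>j. L2_on \<Omega> (chi j) \<and> weakly_div_free \<Omega> (chi j))
     \<and> (\<forall>i j. i \<noteq> j \<longrightarrow> ess_support \<Omega> (chi i) \<inter> ess_support \<Omega> (chi j) = {})"


section \<open>Triangulation and edge elements\<close>

definition verts :: "(real^3) set \<Rightarrow> (real^3) set" where
  "verts T = {v. v extreme_point_of T}"

text \<open>A conforming tetrahedral mesh of \<open>\<Omega>\<close> that resolves the conducting subdomain.\<close>

definition tetrahedral_mesh :: "(real^3) set \<Rightarrow> (real^3) set \<Rightarrow> (real^3) set set \<Rightarrow> bool" where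
  "tetrahedral_mesh \<Omega> \<Omega>C \<T> \<longleftrightarrow>
     triangulation \<T> \<and> (\<forall>T\<in>\<T>. 3 simplex T) \<and> \<Union>\<T> = closure \<Omega>
     \<and> (\<forall>T\<in>\<T>. interior T \<subseteq> \<Omega>C \<or> interior T \<subseteq> nonconducting \<Omega> \<Omega>C)"

text \<open>Edges and faces are represented by their vertex sets.\<close>

definition mesh_edges :: "(real^3) set set \<Rightarrow> (real^3) set set" where
  "mesh_edges \<T> = {E. card E = 2 \<and> (\<exists>T\<in>\<T>. E \<subseteq> verts T)}"

definition mesh_faces :: "(real^3) set set \<Rightarrow> (real^3) set set" where
  "mesh_faces \<T> = {F. card F = 3 \<and> (\<exists>T\<in>\<T>. F \<subseteq> verts T)}"

text \<open>Edges whose basis functions have vanishing tangential trace on \<open>\<partial>\<Omega>\<close>.\<close>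

definition interior_edges :: "(real^3) set \<Rightarrow> (real^3) set set \<Rightarrow> (real^3) set set" where
  "interior_edges \<Omega> \<T> = {E\<in>mesh_edges \<T>. \<not> convex hull E \<subseteq> frontier \<Omega>}"

definition conducting_edges ::
    "(real^3) set \<Rightarrow> (real^3) set \<Rightarrow> (real^3) set set \<Rightarrow> (real^3) set set" where
  "conducting_edges \<Omega> \<Omega>C \<T> =
     {E\<in>interior_edges \<Omega> \<T>. \<exists>T\<in>\<T>. E \<subseteq> verts T \<and> interior T \<subseteq> \<Omega>C}"

type_synonym edge = "(real^3) \<times> (real^3)"
type_synonym face = "(real^3) \<times> (real^3) \<times> (real^3)"

fun edge_verts :: "edge \<Rightarrow> (real^3) set" where
  "edge_verts (p, q) = {p, q}"

fun face_verts :: "face \<Rightarrow> (real^3) set" where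
  "face_verts (p, q, r) = {p, q, r}"

text \<open>Numberings of the oriented edges (conducting ones first) and of the oriented faces.\<close>

definition edge_numbering ::
    "(real^3) set \<Rightarrow> (real^3) set \<Rightarrow> (real^3) set set \<Rightarrow> ('n1 + 'n2 \<Rightarrow> edge) \<Rightarrow> bool" where
  "edge_numbering \<Omega> \<Omega>C \<T> ed \<longleftrightarrow>
     bij_betw (\<lambda>i. edge_verts (ed (Inl i))) UNIV (conducting_edges \<Omega> \<Omega>C \<T>)
     \<and> bij_betw (\<lambda>i. edge_verts (ed (Inr i))) UNIV (interior_edges \<Omega> \<T> - conducting_edges \<Omega> \<Omega>C \<T>)"

definition face_numbering :: "(real^3) set set \<Rightarrow> ('f \<Rightarrow> face) \<Rightarrow> bool" where
  "face_numbering \<T> fc \<longleftrightarrow> bij_betw (\<lambda>k. face_verts (fc k)) UNIV (mesh_faces \<T>)"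

text \<open>\<open>bary T v\<close> is the barycentric coordinate of the tetrahedron \<open>T\<close> belonging to the vertex \<open>v\<close>,
  i.e. the affine function with value 1 at \<open>v\<close> and 0 at the other vertices;
  \<open>bary_grad T v\<close> is its gradient.\<close>

definition bary_grad :: "(real^3) set \<Rightarrow> real^3 \<Rightarrow> real^3" where
  "bary_grad T v = (THE g. \<forall>p\<in>verts T - {v}. g \<bullet> (p - v) = -1)"

definition bary :: "(real^3) set \<Rightarrow> real^3 \<Rightarrow> real^3 \<Rightarrow> real" where
  "bary T v x = 1 + bary_grad T v \<bullet> (x - v)"

text \<open>Lowest-order Nedelec basis function of the first type for the edge oriented from \<open>p\<close>
  to \<open>q\<close>, normalised to have line integral 1 along this edge. Element interiors are disjoint,
  so the sum has at most one term; on the null set of element boundaries the value is 0.\<close>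

fun edge_fun :: "(real^3) set set \<Rightarrow> edge \<Rightarrow> real^3 \<Rightarrow> real^3" where
  "edge_fun \<T> (p, q) x = (\<Sum>T \<in> {T\<in>\<T>. {p, q} \<subseteq> verts T \<and> x \<in> interior T}.
     bary T p x *\<^sub>R bary_grad T q - bary T q x *\<^sub>R bary_grad T p)"

fun incidence :: "face \<Rightarrow> edge \<Rightarrow> real" where
  "incidence (a, b, c) (p, q) =
     (if (p, q) \<in> {(a, b), (b, c), (c, a)} then 1
      else if (q, p) \<in> {(a, b), (b, c), (c, a)} then -1 else 0)"


section \<open>Matrices\<close>

text \<open>A matrix with \<open>n\<close> rows and \<open>m\<close> columns has type \<open>real^'m^'n\<close>; block matrices are indexed by
  sum types.\<close>

definition block_vec :: "real^'a \<Rightarrow> real^'b \<Rightarrow> real^('a::finite + 'b::finite)" where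
  "block_vec v w = (\<chi> i. case i of Inl k \<Rightarrow> v $ k | Inr k \<Rightarrow> w $ k)"

definition upper_vec :: "real^('a::finite + 'b::finite) \<Rightarrow> real^'a" where
  "upper_vec v = (\<chi> i. v $ Inl i)"

definition block_col ::
    "real^'m^'a \<Rightarrow> real^'m^'b \<Rightarrow> real^'m^('a::finite + 'b::finite)" where
  "block_col A B = (\<chi> i. case i of Inl k \<Rightarrow> A $ k | Inr k \<Rightarrow> B $ k)"

definition block_mat ::
    "real^'c^'a \<Rightarrow> real^'d^'a \<Rightarrow> real^'c^'b \<Rightarrow> real^'d^'b \<Rightarrow>
     real^('c::finite + 'd::finite)^('a::finite + 'b::finite)" where
  "block_mat A B C D = (\<chi> i. case i of Inl k \<Rightarrow> block_vec (A $ k) (B $ k)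
                                    | Inr k \<Rightarrow> block_vec (C $ k) (D $ k))"

definition spd :: "real^'n^'n \<Rightarrow> bool" where
  "spd R \<longleftrightarrow> transpose R = R \<and> (\<forall>v. v \<noteq> 0 \<longrightarrow> v \<bullet> (R *v v) > 0)"

definition columns_basis :: "real^'r^'n \<Rightarrow> (real^'n) set \<Rightarrow> bool" where
  "columns_basis Y V \<longleftrightarrow>
     inj (\<lambda>j. column j Y) \<and> independent (columns Y) \<and> span (columns Y) = V"

definition discrete_curl :: "('f \<Rightarrow> face) \<Rightarrow> ('e \<Rightarrow> edge) \<Rightarrow> real^'e^'f" where
  "discrete_curl fc ed = (\<chi> k j. incidence (fc k) (ed j))"

definition mass_matrix ::
    "(real^3) set \<Rightarrow> (real^3 \<Rightarrow> real) \<Rightarrow> ('e \<Rightarrow> real^3 \<Rightarrow> real^3) \<Rightarrow> real^'e^'e" where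
  "mass_matrix \<Omega> \<sigma> \<phi> = (\<chi> k l. \<integral>\<xi>. \<sigma> \<xi> * (\<phi> l \<xi> \<bullet> \<phi> k \<xi>) \<partial>lebesgue_on \<Omega>)"

definition curlcurl_matrix ::
    "(real^3) set \<Rightarrow> (real^3 \<Rightarrow> real \<Rightarrow> real) \<Rightarrow> ('e::finite \<Rightarrow> real^3 \<Rightarrow> real^3) \<Rightarrow>
     real^'e \<Rightarrow> real^'e^'e" where
  "curlcurl_matrix \<Omega> \<nu> \<phi> a = (\<chi> k l.
     \<integral>\<xi>. \<nu> \<xi> (norm (curl (\<lambda>z. \<Sum>j\<in>UNIV. a $ j *\<^sub>R \<phi> j z) \<xi>)) * (curl (\<phi> l) \<xi> \<bullet> curl (\<phi> k) \<xi>)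
       \<partial>lebesgue_on \<Omega>)"

definition winding_matrix ::
    "(real^3) set \<Rightarrow> ('m \<Rightarrow> real^3 \<Rightarrow> real^3) \<Rightarrow> ('e \<Rightarrow> real^3 \<Rightarrow> real^3) \<Rightarrow> real^'m^'e" where
  "winding_matrix \<Omega> chi \<phi> = (\<chi> k j. \<integral>\<xi>. chi j \<xi> \<bullet> \<phi> k \<xi> \<partial>lebesgue_on \<Omega>)"


section \<open>The regularized system\<close>

definition E_r :: "real^'n1^'n1 \<Rightarrow> real^'m^'n1 \<Rightarrow> real^'m^'n2 \<Rightarrow> real^'r^'n2 \<Rightarrow> real^'m^'m \<Rightarrow>
    real^('n1::finite + 'r::finite)^('n1 + 'r)" where
  "E_r M11 X1 X2 Y R =
     block_mat (M11 + X1 ** matrix_inv R ** transpose X1)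
               (X1 ** matrix_inv R ** transpose X2 ** Y)
               (transpose Y ** X2 ** matrix_inv R ** transpose X1)
               (transpose Y ** X2 ** matrix_inv R ** transpose X2 ** Y)"

definition A_r :: "(real^'n1 \<Rightarrow> real^'n1^'n1) \<Rightarrow> real^'n2^'n1 \<Rightarrow> real^'n1^'n2 \<Rightarrow> real^'n2^'n2 \<Rightarrow>
    real^'r^'n2 \<Rightarrow> real^('n1::finite + 'r::finite) \<Rightarrow> real^('n1 + 'r)^('n1 + 'r)" where
  "A_r K11 K12 K21 K22 Y x =
     - block_mat (K11 (upper_vec x)) (K12 ** Y)
                 (transpose Y ** K21) (transpose Y ** K22 ** Y)"

definition B_r :: "real^'m^'n1 \<Rightarrow> real^'m^'n2 \<Rightarrow> real^'r^'n2 \<Rightarrow> real^'m^'m \<Rightarrow>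
    real^'m^('n1::finite + 'r::finite)" where
  "B_r X1 X2 Y R = block_col X1 (transpose Y ** X2) ** matrix_inv R"

text \<open>The output equation \<open>y = - d/dt (B\<^sup>T x) + R\<^sup>-\<^sup>1 u\<close> on \<open>[0,T]\<close>.\<close>

definition mqs_output :: "real^'m^'n \<Rightarrow> real^'m^'m \<Rightarrow> real \<Rightarrow>
    (real \<Rightarrow> real^'n) \<Rightarrow> (real \<Rightarrow> real^'m) \<Rightarrow> (real \<Rightarrow> real^'m) \<Rightarrow> bool" where
  "mqs_output B R T x u y \<longleftrightarrow>
     (\<exists>w. weak_time_derivative T (\<lambda>t. transpose B *v x t) w
        \<and> (AE t in lebesgue_on {0..T}. y t = - w t + matrix_inv R *v u t))"


section \<open>Passivity\<close>

text \<open>Here \<open>A\<close> is the (nonlinear) right-hand side \<open>x \<mapsto> A(x)\<close>, and \<open>Out T x u y\<close> is the output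
  equation on \<open>[0,T]\<close>; it is a relation because the output may involve weak derivatives of the
  state.\<close>

definition trajectory ::
    "real^'n^'n \<Rightarrow> (real^'n \<Rightarrow> real^'n) \<Rightarrow> real^'m^'n \<Rightarrow>
     (real \<Rightarrow> (real \<Rightarrow> real^'n) \<Rightarrow> (real \<Rightarrow> real^'m) \<Rightarrow> (real \<Rightarrow> real^'m) \<Rightarrow> bool) \<Rightarrow>
     real \<Rightarrow> real^'n \<Rightarrow> (real \<Rightarrow> real^'m) \<Rightarrow> (real \<Rightarrow> real^'n) \<Rightarrow> (real \<Rightarrow> real^'m) \<Rightarrow> bool" where
  "trajectory E A B Out T x0 u x y \<longleftrightarrow>
     continuous_on {0..T} x
     \<and> weak_time_derivative T (\<lambda>t. E *v x t) (\<lambda>t. A (x t) + B *v u t)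
     \<and> E *v x 0 = E *v x0 \<and> Out T x u y \<and> L2_on {0..T} y"

definition admissible_input ::
    "real^'n^'n \<Rightarrow> (real^'n \<Rightarrow> real^'n) \<Rightarrow> real^'m^'n \<Rightarrow>
     (real \<Rightarrow> (real \<Rightarrow> real^'n) \<Rightarrow> (real \<Rightarrow> real^'m) \<Rightarrow> (real \<Rightarrow> real^'m) \<Rightarrow> bool) \<Rightarrow>
     real \<Rightarrow> real^'n \<Rightarrow> (real \<Rightarrow> real^'m) \<Rightarrow> bool" where
  "admissible_input E A B Out T x0 u \<longleftrightarrow>
     L2_on {0..T} u \<and> (\<exists>x y. trajectory E A B Out T x0 u x y)"

text \<open>The difference in the dissipation inequality is taken in \<open>ereal\<close>, since subtraction in
  \<open>ennreal\<close> truncates. As \<open>\<infinity> - \<infinity> = \<infinity>\<close> there, the inequality also expresses that the storage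
  function is finite along the trajectories.\<close>

definition storage_function ::
    "real^'n^'n \<Rightarrow> (real^'n \<Rightarrow> real^'n) \<Rightarrow> real^'m^'n \<Rightarrow>
     (real \<Rightarrow> (real \<Rightarrow> real^'n) \<Rightarrow> (real \<Rightarrow> real^'m) \<Rightarrow> (real \<Rightarrow> real^'m) \<Rightarrow> bool) \<Rightarrow>
     (real^'n \<Rightarrow> ennreal) \<Rightarrow> bool" where
  "storage_function E A B Out S \<longleftrightarrow>
     (\<forall>T>0. \<forall>x0 u. S x0 < \<infinity> \<and> admissible_input E A B Out T x0 u \<longrightarrow>
        (\<forall>x y. trajectory E A B Out T x0 u x y \<longrightarrow>
           continuous_on {0..T} (\<lambda>t. S (x t))
           \<and> (\<forall>t0 t1. 0 \<le> t0 \<and> t0 \<le> t1 \<and> t1 \<le> T \<longrightarrow>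
                enn2ereal (S (x t1)) - enn2ereal (S (x t0))
                  \<le> ereal (\<integral>\<tau>. u \<tau> \<bullet> y \<tau> \<partial>lebesgue_on {t0..t1}))))"

text \<open>The function that is identically \<open>\<infinity>\<close> satisfies the above conditions vacuously for every
  system, so storage functions are required to be proper (finite at some state).\<close>

definition passive_system ::
    "real^'n^'n \<Rightarrow> (real^'n \<Rightarrow> real^'n) \<Rightarrow> real^'m^'n \<Rightarrow>
     (real \<Rightarrow> (real \<Rightarrow> real^'n) \<Rightarrow> (real \<Rightarrow> real^'m) \<Rightarrow> (real \<Rightarrow> real^'m) \<Rightarrow> bool) \<Rightarrow> bool" where
  "passive_system E A B Out \<longleftrightarrow>
     (\<exists>S. storage_function E A B Out S \<and> (\<exists>x. S x < \<infinity>))"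

end

theory Submission
  imports Defs
begin

text \<open>The storage function is the magnetic energy
  \<open>S(x) = \<integral> w(\<xi>, \<bar>curl a\<bar>) d\<xi>\<close>, where \<open>a\<close> is the finite element field with coefficient vector
  \<open>(a\<^sub>1, Y a\<^sub>2\<^sub>1)\<close> and \<open>w(\<xi>, \<zeta>) = \<integral>\<^sub>0\<^sup>\<zeta> \<nu>(\<xi>, s) s ds\<close>. Since \<open>\<nu>(\<xi>, s) s\<close> is nondecreasing in
  \<open>s\<close>, this energy is convex, and its gradient is \<open>F(x) = - A\<^sub>r(x) x\<close>. Formally, the chain rule
  with \<open>F = B u - E x'\<close> gives \<open>dS/dt = F \<bullet> x' = u \<bullet> B\<^sup>T x' - x' \<bullet> E x'\<close>. The matrices split as
  \<open>E = D + N P N\<^sup>T\<close> and \<open>B = N P\<close> with \<open>P = R\<^sup>-\<^sup>1\<close> and \<open>D\<close> the positive semidefinite mass matrix, and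
  the output is \<open>y = - B\<^sup>T x' + P u\<close>. Hence, with \<open>q = N\<^sup>T x'\<close>, the supply rate exceeds the energy
  rate by \<open>u \<bullet> y - dS/dt = x' \<bullet> D x' + (u - q) \<bullet> P (u - q) \<ge> 0\<close>.

  The difficulty is that \<open>E\<close> may be singular, so that only \<open>E x\<close> has a weak derivative; the
  component of \<open>x\<close> in the kernel of \<open>E\<close> is merely continuous, and the chain rule for \<open>S(x(t))\<close> is
  not available. Two facts replace it. Because \<open>B\<^sup>T\<close> vanishes on the kernel of \<open>E\<close>, the state
  equation forces \<open>F(x(t))\<close> to be orthogonal to this kernel. Convexity then bounds an increment
  of the energy by \<open>S(x(b)) - S(x(a)) \<le> F(x(b)) \<bullet> (x(b) - x(a))\<close>, in which the kernel component
  drops out: \<open>x(b) - x(a)\<close> may be replaced by \<open>G E (x(b) - x(a)) = \<integral> v\<close>, where \<open>G\<close> is a right inverse of \<open>E\<close>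
  on its range and \<open>v = G (E x)'\<close>. Summing over fine partitions yields
  \<open>S(x(t\<^sub>1)) - S(x(t\<^sub>0)) \<le> \<integral> F(x) \<bullet> v\<close> (\<open>increment_le_integral\<close>), and the computation above applies
  with \<open>v\<close> in place of \<open>x'\<close>. This is \<open>monotone_gradient_system_passive\<close>. It relies on the
  fundamental theorem of calculus for weak derivatives, \<open>weak_time_derivative_integral\<close>, for which
  smooth cutoff functions are constructed first.

  On the finite element side, the curl of an edge function is constant on the interior of every
  tetrahedron, so that up to a null set all curls are simple functions of position; this turns
  \<open>K(a) a\<close> into the gradient of the energy (\<open>stiffness_gradient\<close>). Curls of non-conducting edge
  functions vanish on the conductor, and elsewhere the reluctivity does not depend on the field,
  which gives the block structure of \<open>K(a)\<close>.\<close>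


section \<open>Smooth step functions\<close>

text \<open>For \<open>n = 0\<close> this is the classical smooth function that vanishes to infinite order at the
  origin; the powers of \<open>1/t\<close> are what differentiation produces.\<close>

definition flat :: "nat \<Rightarrow> real \<Rightarrow> real" where
  "flat n t = (if t > 0 then (1 / t) ^ n * exp (- (1 / t)) else 0)"

lemma flat_tendsto_0: "(flat n \<longlongrightarrow> 0) (at 0)"
proof -
  have "((\<lambda>x::real. x ^ n / exp x) \<longlongrightarrow> 0) at_top"
    by (rule tendsto_power_div_exp_0)
  then have "((\<lambda>t::real. inverse t ^ n / exp (inverse t)) \<longlongrightarrow> 0) (at_right 0)"
    by (rule filterlim_compose[OF _ filterlim_inverse_at_top_right])
  moreover have "eventually (\<lambda>t. inverse t ^ n / exp (inverse t) = flat n t) (at_right (0::real))"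
    using eventually_at_right_less[of "0::real"]
    by eventually_elim (simp add: flat_def exp_minus field_simps)
  ultimately have "(flat n \<longlongrightarrow> 0) (at_right 0)"
    by (rule Lim_transform_eventually)
  moreover have "(flat n \<longlongrightarrow> 0) (at_left 0)"
  proof (rule Lim_transform_eventually)
    show "((\<lambda>_. 0) \<longlongrightarrow> 0) (at_left (0::real))" by simp
    show "eventually (\<lambda>t. 0 = flat n t) (at_left 0)"
      by (simp add: eventually_at_filter flat_def)
  qed
  ultimately show ?thesis
    by (simp add: filterlim_split_at)
qed

lemma flat_has_derivative:
  "(flat n has_real_derivative flat (n + 2) t - real n * flat (n + 1) t) (at t)"
proof -
  consider "t < 0" | "t = 0" | "t > 0" by linarith
  then show ?thesis
  proof cases
    case 1
    have "((\<lambda>_. 0) has_real_derivative 0) (at t)" by simp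
    then have "(flat n has_real_derivative 0) (at t)"
      by (rule has_field_derivative_transform_within_open[where S = "{..<0}"])
        (use 1 in \<open>auto simp: flat_def\<close>)
    with 1 show ?thesis by (simp add: flat_def)
  next
    case 2
    have "((\<lambda>h. (flat n (0 + h) - flat n 0) / h) \<longlongrightarrow> 0) (at 0)"
    proof (rule Lim_transform_eventually[OF flat_tendsto_0[of "n + 1"]])
      show "eventually (\<lambda>h. flat (n + 1) h = (flat n (0 + h) - flat n 0) / h) (at 0)"
        by (simp add: eventually_at_filter flat_def)
    qed
    with 2 show ?thesis by (simp add: DERIV_def flat_def)
  next
    case 3
    have "((\<lambda>t. (1 / t) ^ n * exp (- (1 / t))) has_real_derivative
            (1 / t) ^ (n + 2) * exp (- (1 / t)) - real n * ((1 / t) ^ (n + 1) * exp (- (1 / t)))) (at t)"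
    proof (cases n)
      case 0
      then show ?thesis
        using 3 by (auto intro!: derivative_eq_intros simp: power2_eq_square)
    next
      case (Suc k)
      have "((\<lambda>t::real. 1 / t) has_real_derivative - ((1 / t) ^ 2)) (at t)"
        using 3 by (auto intro!: derivative_eq_intros simp: power2_eq_square)
      note DERIV_mult[OF DERIV_power[OF this, of n] DERIV_fun_exp[OF DERIV_minus[OF this]]]
      then show ?thesis
        by (rule DERIV_cong) (simp add: Suc algebra_simps power2_eq_square)
    qed
    then have "(flat n has_real_derivative
            (1 / t) ^ (n + 2) * exp (- (1 / t)) - real n * ((1 / t) ^ (n + 1) * exp (- (1 / t)))) (at t)"
      by (rule has_field_derivative_transform_within_open[where S = "{0<..}"])
        (use 3 in \<open>auto simp: flat_def\<close>)
    with 3 show ?thesis by (simp add: flat_def)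
  qed
qed

text \<open>A class of functions that is closed under differentiation, so that all of its members are
  smooth by coinduction. It avoids a general product and chain rule for \<open>smooth\<close>.\<close>

inductive flat_algebra :: "(real \<Rightarrow> real) \<Rightarrow> bool" where
  const: "flat_algebra (\<lambda>_. c)"
| flat: "flat_algebra (\<lambda>t. flat n (c * t + d))"
| add: "flat_algebra f \<Longrightarrow> flat_algebra g \<Longrightarrow> flat_algebra (\<lambda>t. f t + g t)"
| mult: "flat_algebra f \<Longrightarrow> flat_algebra g \<Longrightarrow> flat_algebra (\<lambda>t. f t * g t)"

lemma flat_algebra_derivative:
  assumes "flat_algebra f"
  shows "\<exists>f'. flat_algebra f' \<and> (\<forall>t. (f has_real_derivative f' t) (at t))"
  using assms
proof induction
  case (const c)
  have "((\<lambda>_. c) has_real_derivative 0) (at t)" for t by simp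
  then show ?case using flat_algebra.const by blast
next
  case (flat n c d)
  have "((\<lambda>t. flat n (c * t + d)) has_real_derivative
          c * (flat (n + 2) (c * t + d) + (- real n) * flat (n + 1) (c * t + d))) (at t)" for t
    by (rule DERIV_chain2[OF flat_has_derivative, THEN DERIV_cong])
      (auto intro!: derivative_eq_intros simp: algebra_simps)
  moreover have "flat_algebra (\<lambda>t. c * (flat (n + 2) (c * t + d) + (- real n) * flat (n + 1) (c * t + d)))"
    by (intro flat_algebra.intros)
  ultimately show ?case by blast
next
  case (add f g)
  then obtain f' g' where *: "flat_algebra f'" "flat_algebra g'"
    "\<And>t. (f has_real_derivative f' t) (at t)" "\<And>t. (g has_real_derivative g' t) (at t)" by blast
  have "((\<lambda>t. f t + g t) has_real_derivative f' t + g' t) (at t)" for t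
    by (intro derivative_intros *)
  with *(1,2) show ?case using flat_algebra.add by blast
next
  case (mult f g)
  then obtain f' g' where *: "flat_algebra f'" "flat_algebra g'"
    "\<And>t. (f has_real_derivative f' t) (at t)" "\<And>t. (g has_real_derivative g' t) (at t)" by blast
  have "((\<lambda>t. f t * g t) has_real_derivative f' t * g t + f t * g' t) (at t)" for t
    by (rule DERIV_cong[OF DERIV_mult[OF *(3,4)]]) (simp add: mult.commute)
  moreover have "flat_algebra (\<lambda>t. f' t * g t + f t * g' t)"
    by (intro flat_algebra.intros * mult.hyps)
  ultimately show ?case by blast
qed

lemma partial_1_eq_derivative:
  assumes "(f has_real_derivative D) (at t)"
  shows "partial 1 f t = D"
  using frechet_derivative_at[OF assms[unfolded has_field_derivative_def]]
  by (simp add: partial_def fun_eq_iff) (metis mult.right_neutral)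

lemma smooth_flat_algebra: "flat_algebra f \<Longrightarrow> smooth f"
proof (coinduction arbitrary: f)
  case smooth
  obtain f' where f': "flat_algebra f'" "\<And>t. (f has_real_derivative f' t) (at t)"
    using flat_algebra_derivative[OF smooth] by blast
  then have "partial 1 f = f'"
    using partial_1_eq_derivative by blast
  moreover have "\<forall>t. f differentiable at t"
    using f'(2) real_differentiable_def by blast
  ultimately show ?case using f'(1) by auto
qed

lemma smooth_antiderivative:
  assumes "\<And>t. (f has_real_derivative f' t) (at t)" "smooth f'"
  shows "smooth f"
proof (rule smooth.intros)
  show "\<forall>t. f differentiable at t"
    using assms(1) real_differentiable_def by blast
  have "partial 1 f = f'"
    using partial_1_eq_derivative assms(1) by blast
  then show "\<forall>b\<in>Basis. smooth (partial b f)" using assms(2) by simp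
qed

text \<open>The step \<open>H\<close> is the normalised antiderivative of the bump \<open>flat 0 t * flat 0 (1 - t)\<close>. Smoothness
  is recorded only for the difference of two rescaled bumps: that is the derivative of the cutoff
  function of an interval.\<close>

lemma smooth_step_exists:
  obtains \<rho> H :: "real \<Rightarrow> real" where
    "\<And>n a b. smooth (\<lambda>t. n * \<rho> (n * (t - a)) - n * \<rho> (n * (t - b)))" "continuous_on UNIV \<rho>" "\<And>t. \<rho> t \<ge> 0"
    "\<And>t. t \<notin> {0..1} \<Longrightarrow> \<rho> t = 0"
    "\<And>t. (H has_real_derivative \<rho> t) (at t)" "\<And>t. t \<le> 0 \<Longrightarrow> H t = 0" "\<And>t. t \<ge> 1 \<Longrightarrow> H t = 1"
    "\<And>t. 0 \<le> H t" "\<And>t. H t \<le> 1"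
proof -
  define \<eta> where "\<eta> t = flat 0 t * flat 0 (1 - t)" for t
  have cont_flat: "continuous_on UNIV (flat n)" for n
    by (meson DERIV_isCont continuous_at_imp_continuous_on flat_has_derivative)
  have cont: "continuous_on A \<eta>" for A
    unfolding \<eta>_def
    by (intro continuous_intros continuous_on_compose2[OF cont_flat]) auto
  have nonneg: "\<eta> t \<ge> 0" for t by (simp add: \<eta>_def flat_def)
  have zero: "\<eta> t = 0" if "t \<notin> {0<..<1}" for t using that by (auto simp: \<eta>_def flat_def)
  define G where "G t = integral {-1..t} \<eta>" for t
  have G_le0: "G t = 0" if "t \<le> 0" for t
  proof -
    have "G t = integral {-1..t} (\<lambda>_. 0)"
      unfolding G_def by (rule integral_cong) (use that zero in auto)
    then show ?thesis by simp
  qed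
  have G_deriv: "(G has_real_derivative \<eta> t) (at t)" for t
  proof (cases "t < 0")
    case True
    have "((\<lambda>_. 0) has_real_derivative 0) (at t)" by simp
    then have "(G has_real_derivative 0) (at t)"
      by (rule has_field_derivative_transform_within_open[where S = "{..<0}"])
        (use True G_le0 in auto)
    then show ?thesis using zero True by simp
  next
    case False
    have "(G has_vector_derivative \<eta> t) (at t within {-1..t + 1})"
      unfolding G_def using False
      by (intro integral_has_vector_derivative cont) auto
    then have "(G has_vector_derivative \<eta> t) (at t)"
      using False by (subst (asm) at_within_interior) auto
    then show ?thesis by (simp add: has_real_derivative_iff_has_vector_derivative)
  qed
  define c where "c = G 1"
  have G_mono: "G s \<le> G t" if "s \<le> t" for s t
    by (rule DERIV_nonneg_imp_nondecreasing[OF that]) (use G_deriv nonneg in blast)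
  have G_ge1: "G t = c" if "t \<ge> 1" for t
  proof (cases "t = 1")
    case False
    have "\<exists>z. z > 1 \<and> z < t \<and> G t - G 1 = (t - 1) * \<eta> z"
      by (rule MVT2) (use that False G_deriv in auto)
    then show ?thesis using zero by (auto simp: c_def)
  qed (simp add: c_def)
  \<comment> \<open>Otherwise the nondecreasing \<open>G\<close> would vanish on \<open>[0,1]\<close>, and so would its derivative \<open>\<eta>\<close>.\<close>
  have "c > 0"
  proof (rule ccontr)
    assume "\<not> c > 0"
    then have "G t = 0" if "t \<in> {0<..<1}" for t
      using G_mono[of 0 t] G_mono[of t 1] G_le0[of 0] that by (auto simp: c_def)
    then have "(G has_real_derivative 0) (at (1/2))"
      by (intro has_field_derivative_transform_within_open[where S = "{0<..<1}" and f = "\<lambda>_. 0", OF DERIV_const]) simp_all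
    then have "\<eta> (1/2) = 0" by (rule DERIV_unique[OF G_deriv])
    then show False by (simp add: \<eta>_def flat_def)
  qed
  show ?thesis
  proof
    fix n a b :: real
    have "flat_algebra (\<lambda>t. (n / c) * (flat 0 (n * t + - (n * a)) * flat 0 ((- n) * t + (1 + n * a)))
        + (- (n / c)) * (flat 0 (n * t + - (n * b)) * flat 0 ((- n) * t + (1 + n * b))))"
      by (intro flat_algebra.intros)
    from smooth_flat_algebra[OF this]
    show "smooth (\<lambda>t. n * (\<eta> (n * (t - a)) / c) - n * (\<eta> (n * (t - b)) / c))"
      by (simp add: \<eta>_def algebra_simps)
    show "continuous_on UNIV (\<lambda>t. \<eta> t / c)" using cont \<open>c > 0\<close> by (intro continuous_intros) auto
  next
    fix t :: real
    show "\<eta> t / c \<ge> 0" using nonneg \<open>c > 0\<close> by simp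
    show "\<eta> t / c = 0" if "t \<notin> {0..1}" using zero[of t] that by auto
    show "((\<lambda>t. G t / c) has_real_derivative \<eta> t / c) (at t)"
      using G_deriv by (rule DERIV_cdivide)
    show "G t / c = 0" if "t \<le> 0" using G_le0 that by simp
    show "G t / c = 1" if "t \<ge> 1" using G_ge1 that \<open>c > 0\<close> by simp
    show "0 \<le> G t / c" using G_mono[of "min 0 t" t] G_le0[of "min 0 t"] \<open>c > 0\<close> by simp
    show "G t / c \<le> 1" using G_mono[of t "max 1 t"] G_ge1[of "max 1 t"] \<open>c > 0\<close> by simp
  qed
qed

section \<open>Weak time derivatives\<close>

lemma integral_lebesgue_on_support:
  fixes h :: "'a::euclidean_space \<Rightarrow> 'b::euclidean_space"
  assumes "K \<subseteq> S" "K \<in> sets lebesgue" "S \<in> sets lebesgue" "\<And>x. x \<in> S - K \<Longrightarrow> h x = 0"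
  shows "(\<integral>x. h x \<partial>lebesgue_on S) = (\<integral>x. h x \<partial>lebesgue_on K)"
proof -
  have "(\<integral>x. h x \<partial>lebesgue_on S) = (\<integral>x. (if x \<in> K then h x else 0) \<partial>lebesgue_on S)"
    by (rule Bochner_Integration.integral_cong) (use assms(4) in auto)
  also have "\<dots> = (\<integral>x. h x \<partial>lebesgue_on K)"
    by (rule integral_restrict) (use assms in auto)
  finally show ?thesis .
qed

text \<open>The kernel \<open>n \<rho>(n (t - p))\<close> is the derivative of \<open>H(n (t - p))\<close>, which increases from 0 to 1 on
  \<open>[p, p + 1/n]\<close>; it is a one-sided approximate identity, and so \<open>p\<close> may be the left endpoint.\<close>

lemma mollifier_tendsto:
  fixes f :: "real \<Rightarrow> 'b::euclidean_space"
  assumes f: "continuous_on {a..c} f" and p: "a \<le> p" "p < c"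
    and \<rho>: "continuous_on UNIV \<rho>" "\<And>t. \<rho> t \<ge> 0" "\<And>t. t \<notin> {0..1} \<Longrightarrow> \<rho> t = 0"
    and H: "\<And>t. (H has_real_derivative \<rho> t) (at t)" "\<And>t. t \<le> 0 \<Longrightarrow> H t = 0" "\<And>t. t \<ge> 1 \<Longrightarrow> H t = 1"
  shows "(\<lambda>n. \<integral>t. (real n * \<rho> (real n * (t - p))) *\<^sub>R f t \<partial>lebesgue_on {a..c}) \<longlonglongrightarrow> f p"
proof (rule LIMSEQ_I)
  fix e :: real assume "e > 0"
  then have "e / 2 > 0" by simp
  then obtain d where d: "d > 0" "\<And>t. t \<in> {a..c} \<Longrightarrow> dist t p < d \<Longrightarrow> dist (f t) (f p) < e / 2"
    using f p unfolding continuous_on_iff by (metis atLeastAtMost_iff less_imp_le)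
  \<comment> \<open>Beyond \<open>N\<close> the kernel is supported within distance \<open>d\<close> of \<open>p\<close> and inside \<open>[a, c]\<close>.\<close>
  define N where "N = nat \<lceil>max (1 / d) (1 / (c - p))\<rceil> + 1"
  show "\<exists>N. \<forall>n\<ge>N. norm ((\<integral>t. (real n * \<rho> (real n * (t - p))) *\<^sub>R f t \<partial>lebesgue_on {a..c}) - f p) < e"
  proof (intro exI allI impI)
    fix n assume "n \<ge> N"
    then have n: "real n > 1 / d" "real n > 1 / (c - p)" "n > 0"
      unfolding N_def by linarith+
    then have nd: "real n * d > 1" and nc: "real n * (c - p) > 1"
      using d p by (auto simp: field_simps)
    let ?w = "\<lambda>t. real n * \<rho> (real n * (t - p))"
    have w_cont: "continuous_on A ?w" for A
      by (intro continuous_intros continuous_on_compose2[OF \<rho>(1)]) auto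
    have w_int: "integrable (lebesgue_on {a..c}) ?w"
      using w_cont by (rule continuous_imp_integrable_real)
    have wf_int: "integrable (lebesgue_on {a..c}) (\<lambda>t. ?w t *\<^sub>R g t)" if "continuous_on {a..c} g" for g :: "real \<Rightarrow> 'b"
      by (intro continuous_imp_integrable_real continuous_intros w_cont that)
    have "(?w has_integral H (real n * (c - p)) - H (real n * (a - p))) {a..c}"
    proof (rule fundamental_theorem_of_calculus)
      show "a \<le> c" using p by simp
      fix t
      have "((\<lambda>t. H (real n * (t - p))) has_real_derivative ?w t) (at t within {a..c})"
        by (rule DERIV_cong[OF DERIV_chain2[OF H(1)]]) (auto intro!: derivative_eq_intros)
      then show "((\<lambda>t. H (real n * (t - p))) has_vector_derivative ?w t) (at t within {a..c})"
        by (simp add: has_real_derivative_iff_has_vector_derivative)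
    qed
    moreover have "H (real n * (a - p)) = 0"
      using p n by (intro H) (auto simp: mult_le_0_iff)
    ultimately have one: "(\<integral>t. ?w t \<partial>lebesgue_on {a..c}) = 1"
      using nc H(3)[of "real n * (c - p)"] lebesgue_integral_eq_integral[OF w_int]
      by (simp only: integral_unique) simp
    have "(\<integral>t. ?w t *\<^sub>R f t \<partial>lebesgue_on {a..c}) - f p
      = (\<integral>t. ?w t *\<^sub>R f t \<partial>lebesgue_on {a..c}) - (\<integral>t. ?w t *\<^sub>R f p \<partial>lebesgue_on {a..c})"
      using one w_int by simp
    also have "\<dots> = (\<integral>t. ?w t *\<^sub>R f t - ?w t *\<^sub>R f p \<partial>lebesgue_on {a..c})"
      by (rule Bochner_Integration.integral_diff[symmetric]) (intro wf_int f continuous_intros)+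
    also have "norm \<dots> \<le> (\<integral>t. ?w t * (e / 2) \<partial>lebesgue_on {a..c})"
    proof (rule order_trans[OF integral_norm_bound integral_mono])
      show "integrable (lebesgue_on {a..c}) (\<lambda>t. norm (?w t *\<^sub>R f t - ?w t *\<^sub>R f p))"
        by (intro integrable_norm Bochner_Integration.integrable_diff wf_int f continuous_intros)
      show "integrable (lebesgue_on {a..c}) (\<lambda>t. ?w t * (e / 2))"
        using w_int by simp
      fix t assume t: "t \<in> space (lebesgue_on {a..c})"
      show "norm (?w t *\<^sub>R f t - ?w t *\<^sub>R f p) \<le> ?w t * (e / 2)"
      proof (cases "real n * (t - p) \<in> {0..1}")
        case True
        then have "real n * (t - p) < real n * d" using nd by simp
        then have "t - p < d" using n by simp
        moreover have "t \<ge> p" using True n by (simp add: zero_le_mult_iff)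
        ultimately have "dist (f t) (f p) < e / 2" using d(2) t by (simp add: dist_real_def)
        moreover have "norm (?w t *\<^sub>R f t - ?w t *\<^sub>R f p) = ?w t * dist (f t) (f p)"
          using \<rho>(2) by (simp add: scaleR_diff_right[symmetric] dist_norm abs_mult)
        moreover have "?w t \<ge> 0" using \<rho>(2) by simp
        ultimately show ?thesis by (metis less_imp_le mult_left_mono)
      qed (use \<rho>(3) in auto)
    qed
    also have "\<dots> = e / 2" using one w_int by simp
    also have "\<dots> < e" using \<open>e > 0\<close> by simp
    finally show "norm ((\<integral>t. ?w t *\<^sub>R f t \<partial>lebesgue_on {a..c}) - f p) < e" .
  qed
qed

text \<open>The fundamental theorem of calculus for weak derivatives. It is tested with smooth cutoffs \<open>\<psi> n\<close>
  that increase to 1 just after \<open>a\<close> and decrease to 0 just after \<open>b\<close>: they converge to the indicator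
  of the interval, and their derivatives to the difference of the point evaluations at \<open>a\<close> and \<open>b\<close>.\<close>

lemma weak_time_derivative_integral:
  fixes f g :: "real \<Rightarrow> 'b::euclidean_space"
  assumes wd: "weak_time_derivative T f g" and f: "continuous_on {0<..<T} f"
    and ab: "0 < a" "a \<le> b" "b < T"
  shows "(\<integral>t. g t \<partial>lebesgue_on {a..b}) = f b - f a"
proof -
  obtain \<rho> H where \<rho>: "\<And>n a b. smooth (\<lambda>t. n * \<rho> (n * (t - a)) - n * \<rho> (n * (t - b)))" "continuous_on UNIV \<rho>" "\<And>t. \<rho> t \<ge> 0"
    "\<And>t. t \<notin> {0..1} \<Longrightarrow> \<rho> t = 0"
    and H: "\<And>t. (H has_real_derivative \<rho> t) (at t)" "\<And>t. t \<le> 0 \<Longrightarrow> H t = 0" "\<And>t. t \<ge> 1 \<Longrightarrow> H t = 1"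
    "\<And>t. 0 \<le> H t" "\<And>t. H t \<le> 1"
    by (rule smooth_step_exists) blast
  define c where "c = (b + T) / 2"
  have c: "b < c" "c < T" using ab by (auto simp: c_def)
  have sub: "{a..c} \<subseteq> {0<..<T}" using ab c by auto
  have fc: "continuous_on {a..c} f" using f sub by (rule continuous_on_subset)
  define w where "w p n t = real n * \<rho> (real n * (t - p))" for p n t
  define \<psi> where "\<psi> n t = H (real n * (t - a)) - H (real n * (t - b))" for n t
  have \<psi>_deriv: "(\<psi> n has_real_derivative w a n t - w b n t) (at t)" for n t
  proof -
    have "((\<lambda>t. H (real n * (t - p))) has_real_derivative w p n t) (at t)" for p
      unfolding w_def
      by (rule DERIV_cong[OF DERIV_chain2[OF H(1)]]) (auto intro!: derivative_eq_intros)
    from DERIV_diff[OF this this] show ?thesis unfolding \<psi>_def .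
  qed
  have g_int: "integrable (lebesgue_on {a..c}) g"
    using wd sub unfolding weak_time_derivative_def weak_partial_def loc_integrable_on_def by auto
  have w_int: "integrable (lebesgue_on {a..c}) (\<lambda>t. w p n t *\<^sub>R f t)" for p n
    unfolding w_def
    by (intro continuous_imp_integrable_real continuous_intros fc continuous_on_compose2[OF \<rho>(2)]) auto
  \<comment> \<open>As soon as \<open>1/n \<le> c - b\<close>, the cutoff is supported in \<open>[a, c]\<close> and is a test function.\<close>
  have key: "(\<integral>t. w a n t *\<^sub>R f t \<partial>lebesgue_on {a..c}) - (\<integral>t. w b n t *\<^sub>R f t \<partial>lebesgue_on {a..c})
      = - (\<integral>t. \<psi> n t *\<^sub>R g t \<partial>lebesgue_on {a..c})" if "real n * (c - b) \<ge> 1" for n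
  proof -
    have "n > 0" using that by (cases n) auto
    have zero: "\<psi> n t = 0 \<and> w a n t - w b n t = 0" if t: "t \<notin> {a..c}" for t
    proof (cases "t < a")
      case True
      then have "real n * (t - a) < 0" "real n * (t - b) < 0"
        using ab \<open>n > 0\<close> by (auto simp: mult_less_0_iff)
      then show ?thesis using H(2) \<rho>(4) by (simp add: \<psi>_def w_def)
    next
      case False
      with t have "t > c" by auto
      then have "real n * (t - b) > real n * (c - b)" "real n * (t - a) \<ge> real n * (t - b)"
        using \<open>n > 0\<close> ab by auto
      then have "real n * (t - b) > 1" "real n * (t - a) > 1"
        using \<open>real n * (c - b) \<ge> 1\<close> by linarith+
      then show ?thesis using H(3) \<rho>(4) by (simp add: \<psi>_def w_def)
    qed
    have "smooth (\<lambda>t. w a n t - w b n t)"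
      unfolding w_def by (rule \<rho>(1))
    then have "smooth (\<psi> n)"
      using \<psi>_deriv by (rule smooth_antiderivative[rotated])
    moreover have cl: "closure {t. \<psi> n t \<noteq> 0} \<subseteq> {a..c}"
    proof (rule closure_minimal)
      show "{t. \<psi> n t \<noteq> 0} \<subseteq> {a..c}" using zero by blast
    qed simp
    ultimately have "test_function {0<..<T} (\<psi> n)"
      unfolding test_function_def using sub
      by (meson bounded_closed_interval bounded_subset closed_closure compact_eq_bounded_closed subset_trans)
    then have "(\<integral>t. partial 1 (\<psi> n) t *\<^sub>R f t \<partial>lebesgue_on {0<..<T}) = - (\<integral>t. \<psi> n t *\<^sub>R g t \<partial>lebesgue_on {0<..<T})"
      using wd unfolding weak_time_derivative_def weak_partial_def by blast
    then have "(\<integral>t. (w a n t - w b n t) *\<^sub>R f t \<partial>lebesgue_on {0<..<T}) = - (\<integral>t. \<psi> n t *\<^sub>R g t \<partial>lebesgue_on {0<..<T})"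
      using partial_1_eq_derivative[OF \<psi>_deriv] by simp
    moreover have "(\<integral>t. (w a n t - w b n t) *\<^sub>R f t \<partial>lebesgue_on {0<..<T}) = (\<integral>t. (w a n t - w b n t) *\<^sub>R f t \<partial>lebesgue_on {a..c})"
      by (rule integral_lebesgue_on_support) (use sub zero in auto)
    moreover have "(\<integral>t. \<psi> n t *\<^sub>R g t \<partial>lebesgue_on {0<..<T}) = (\<integral>t. \<psi> n t *\<^sub>R g t \<partial>lebesgue_on {a..c})"
      by (rule integral_lebesgue_on_support) (use sub zero in auto)
    moreover have "(\<integral>t. (w a n t - w b n t) *\<^sub>R f t \<partial>lebesgue_on {a..c})
        = (\<integral>t. w a n t *\<^sub>R f t \<partial>lebesgue_on {a..c}) - (\<integral>t. w b n t *\<^sub>R f t \<partial>lebesgue_on {a..c})"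
      using Bochner_Integration.integral_diff[OF w_int w_int, of a n b n] by (simp add: scaleR_diff_left)
    ultimately show ?thesis by simp
  qed
  have "(\<lambda>n. \<integral>t. \<psi> n t *\<^sub>R g t \<partial>lebesgue_on {a..c}) \<longlonglongrightarrow> (\<integral>t. indicator {a<..b} t *\<^sub>R g t \<partial>lebesgue_on {a..c})"
  proof (rule integral_dominated_convergence)
    show "(\<lambda>t. indicator {a<..b} t *\<^sub>R g t) \<in> borel_measurable (lebesgue_on {a..c})"
      using g_int ab c by (intro borel_measurable_scaleR borel_measurable_indicator) (auto simp: sets_restrict_space_iff)
    have "continuous_on UNIV H"
      by (meson DERIV_isCont H(1) continuous_at_imp_continuous_on)
    then have "continuous_on {a..c} (\<psi> n)" for n
      unfolding \<psi>_def
      by (intro continuous_on_diff continuous_on_compose2[OF \<open>continuous_on UNIV H\<close>] continuous_intros) auto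
    then have "\<psi> n \<in> borel_measurable (lebesgue_on {a..c})" for n
      by (intro continuous_imp_measurable_on_sets_lebesgue) auto
    then show "(\<lambda>t. \<psi> n t *\<^sub>R g t) \<in> borel_measurable (lebesgue_on {a..c})" for n
      using g_int by (intro borel_measurable_scaleR) auto
    show "integrable (lebesgue_on {a..c}) (\<lambda>t. norm (g t))" using g_int by simp
    have "norm (\<psi> n t) \<le> 1" for n t
      using H(4,5)[of "real n * (t - a)"] H(4,5)[of "real n * (t - b)"] by (simp add: \<psi>_def)
    then show "AE t in lebesgue_on {a..c}. norm (\<psi> n t *\<^sub>R g t) \<le> norm (g t)" for n
      by (simp add: mult_left_le_one_le)
    show "AE t in lebesgue_on {a..c}. (\<lambda>n. \<psi> n t *\<^sub>R g t) \<longlonglongrightarrow> indicator {a<..b} t *\<^sub>R g t"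
    proof (intro AE_I2 tendsto_scaleR tendsto_const)
      fix t
      have step: "(\<lambda>n. H (real n * s)) \<longlonglongrightarrow> indicator {0<..} s" for s
      proof (cases "s > 0")
        case True
        have "eventually (\<lambda>n. H (real n * s) = 1) sequentially"
        proof (rule eventually_sequentiallyI)
          fix n assume "nat \<lceil>1 / s\<rceil> \<le> n"
          then have "1 / s \<le> real n" by linarith
          then show "H (real n * s) = 1" using True by (intro H) (simp add: field_simps)
        qed
        then show ?thesis using True by (simp add: tendsto_eventually)
      next
        case False
        then have "H (real n * s) = 0" for n by (intro H) (simp add: mult_nonneg_nonpos)
        with False show ?thesis by simp
      qed
      have "(\<lambda>n. \<psi> n t) \<longlonglongrightarrow> indicator {0<..} (t - a) - indicator {0<..} (t - b)"
        unfolding \<psi>_def by (intro tendsto_diff step)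
      moreover have "indicator {0<..} (t - a) - indicator {0<..} (t - b) = (indicator {a<..b} t :: real)"
        using ab by (auto simp: indicator_def)
      ultimately show "(\<lambda>n. \<psi> n t) \<longlonglongrightarrow> indicator {a<..b} t" by simp
    qed
  qed
  moreover have "(\<integral>t. indicator {a<..b} t *\<^sub>R g t \<partial>lebesgue_on {a..c}) = (\<integral>t. g t \<partial>lebesgue_on {a..b})"
  proof -
    have "(\<integral>t. indicator {a<..b} t *\<^sub>R g t \<partial>lebesgue_on {a..c}) = (\<integral>t. indicator {a..b} t *\<^sub>R g t \<partial>lebesgue_on {a..c})"
    proof (rule integral_cong_AE)
      show "(\<lambda>t. indicator {a<..b} t *\<^sub>R g t) \<in> borel_measurable (lebesgue_on {a..c})"
         "(\<lambda>t. indicator {a..b} t *\<^sub>R g t) \<in> borel_measurable (lebesgue_on {a..c})"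
        using g_int ab c by (auto intro!: borel_measurable_scaleR borel_measurable_indicator simp: sets_restrict_space_iff)
      show "AE t in lebesgue_on {a..c}. indicator {a<..b} t *\<^sub>R g t = indicator {a..b} t *\<^sub>R g t"
        by (rule AE_I'[where N = "{a}"])
          (use c ab in \<open>auto simp: indicator_def null_sets_restrict_space split: if_splits\<close>)
    qed
    also have "\<dots> = (\<integral>t. (if t \<in> {a..b} then g t else 0) \<partial>lebesgue_on {a..c})"
      by (rule Bochner_Integration.integral_cong) (auto simp: indicator_def)
    also have "\<dots> = (\<integral>t. g t \<partial>lebesgue_on {a..b})"
      by (rule integral_restrict) (use c in auto)
    finally show ?thesis .
  qed
  ultimately have lim1: "(\<lambda>n. - (\<integral>t. \<psi> n t *\<^sub>R g t \<partial>lebesgue_on {a..c})) \<longlonglongrightarrow> - (\<integral>t. g t \<partial>lebesgue_on {a..b})"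
    by (simp add: tendsto_minus)
  have lim2: "(\<lambda>n. (\<integral>t. w a n t *\<^sub>R f t \<partial>lebesgue_on {a..c}) - (\<integral>t. w b n t *\<^sub>R f t \<partial>lebesgue_on {a..c}))
      \<longlonglongrightarrow> f a - f b"
    unfolding w_def using ab c
    by (intro tendsto_diff mollifier_tendsto[OF fc _ _ \<rho>(2-4) H(1-3)]) auto
  have "eventually (\<lambda>n. (\<integral>t. w a n t *\<^sub>R f t \<partial>lebesgue_on {a..c}) - (\<integral>t. w b n t *\<^sub>R f t \<partial>lebesgue_on {a..c})
      = - (\<integral>t. \<psi> n t *\<^sub>R g t \<partial>lebesgue_on {a..c})) sequentially"
  proof (rule eventually_sequentiallyI)
    fix n assume "nat \<lceil>1 / (c - b)\<rceil> \<le> n"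
    then have "1 / (c - b) \<le> real n" by linarith
    then show "(\<integral>t. w a n t *\<^sub>R f t \<partial>lebesgue_on {a..c}) - (\<integral>t. w b n t *\<^sub>R f t \<partial>lebesgue_on {a..c})
      = - (\<integral>t. \<psi> n t *\<^sub>R g t \<partial>lebesgue_on {a..c})"
      using c by (intro key) (simp add: field_simps)
  qed
  with lim2 have "(\<lambda>n. - (\<integral>t. \<psi> n t *\<^sub>R g t \<partial>lebesgue_on {a..c})) \<longlonglongrightarrow> f a - f b"
    by (rule Lim_transform_eventually)
  then have "f a - f b = - (\<integral>t. g t \<partial>lebesgue_on {a..b})"
    using lim1 by (rule LIMSEQ_unique)
  then show ?thesis by (metis minus_diff_eq minus_equation_iff)
qed

text \<open>The sets over which \<open>h\<close> integrates to 0 form a Dynkin system containing the half-lines, hence all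
  Borel sets; Lebesgue sets differ from these by null sets.\<close>

lemma AE_eq_0_if_interval_integrals_0:
  fixes h :: "real \<Rightarrow> 'b::euclidean_space"
  assumes h: "integrable (lebesgue_on {\<alpha>..\<beta>}) h"
    and zero: "\<And>a b. \<alpha> \<le> a \<Longrightarrow> a \<le> b \<Longrightarrow> b \<le> \<beta> \<Longrightarrow> (\<integral>t. h t \<partial>lebesgue_on {a..b}) = 0"
  shows "AE t in lebesgue_on {\<alpha>..\<beta>}. h t = 0"
proof (cases "\<alpha> \<le> \<beta>")
  case False
  then show ?thesis by (intro AE_I2) simp
next
  case True
  let ?M = "lebesgue_on {\<alpha>..\<beta>}"
  have [measurable]: "h \<in> borel_measurable ?M" using h by auto
  have sets: "A \<in> sets lebesgue \<Longrightarrow> A \<inter> {\<alpha>..\<beta>} \<in> sets ?M" for A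
    by (auto simp: sets_restrict_space)
  have int: "integrable ?M (\<lambda>t. indicator A t *\<^sub>R h t)" if "A \<in> sets lebesgue" for A
  proof -
    have "integrable ?M (\<lambda>t. indicator (A \<inter> {\<alpha>..\<beta>}) t *\<^sub>R h t)"
      by (rule integrable_mult_indicator[OF sets[OF that] h])
    then show ?thesis
      by (rule Bochner_Integration.integrable_cong[THEN iffD1, rotated -1]) (auto simp: indicator_def)
  qed
  have borel: "(\<integral>t. indicator A t *\<^sub>R h t \<partial>?M) = 0" if "A \<in> sets borel" for A
  proof -
    have "Int_stable (range (\<lambda>a::real. {a..}))"
    proof (clarsimp simp: Int_stable_def)
      fix a b :: real
      have "{a..} \<inter> {b..} = {max a b..}" by auto
      then show "{a..} \<inter> {b..} \<in> range atLeast" by blast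
    qed
    moreover have "range (\<lambda>a::real. {a..}) \<subseteq> Pow UNIV" by simp
    moreover have "A \<in> sigma_sets UNIV (range (\<lambda>a. {a..}))"
      using that unfolding borel_Ici by simp
    ultimately show ?thesis
    proof (induction rule: sigma_sets_induct_disjoint)
      case (basic A)
      then obtain a where A: "A = {a..}" by auto
      have "(\<integral>t. indicator A t *\<^sub>R h t \<partial>?M) = (\<integral>t. (if t \<in> {max a \<alpha>..\<beta>} then h t else 0) \<partial>?M)"
        by (rule Bochner_Integration.integral_cong) (auto simp: A indicator_def)
      also have "\<dots> = (\<integral>t. h t \<partial>lebesgue_on {max a \<alpha>..\<beta>})"
        by (rule integral_restrict) auto
      also have "\<dots> = 0"
        by (cases "max a \<alpha> \<le> \<beta>") (use zero in auto)
      finally show ?case .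
    next
      case empty
      then show ?case by simp
    next
      case (compl A)
      then have A: "A \<in> sets borel" unfolding borel_Ici by simp
      have "(\<integral>t. indicator (UNIV - A) t *\<^sub>R h t \<partial>?M) = (\<integral>t. h t - indicator A t *\<^sub>R h t \<partial>?M)"
        by (rule Bochner_Integration.integral_cong) (auto simp: indicator_def)
      also have "\<dots> = (\<integral>t. h t \<partial>?M) - (\<integral>t. indicator A t *\<^sub>R h t \<partial>?M)"
        by (rule Bochner_Integration.integral_diff[OF h int]) (use A in auto)
      finally show ?case using compl zero[of \<alpha> \<beta>] True by simp
    next
      case (union A)
      then have A: "A i \<in> sets borel" for i unfolding borel_Ici by auto
      have "(\<lambda>i. \<integral>t. indicator (\<Union>j<i. A j) t *\<^sub>R h t \<partial>?M) \<longlonglongrightarrow> (\<integral>t. indicator (\<Union>j. A j) t *\<^sub>R h t \<partial>?M)"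
      proof (rule integral_dominated_convergence)
        show "integrable ?M (\<lambda>t. norm (h t))" using h by simp
        show "(\<lambda>t. indicator (\<Union>j. A j) t *\<^sub>R h t) \<in> borel_measurable ?M"
          using A int[of "\<Union>j. A j"] by auto
        show "(\<lambda>t. indicator (\<Union>j<i. A j) t *\<^sub>R h t) \<in> borel_measurable ?M" for i
          using A int[of "\<Union>j<i. A j"] by auto
        show "AE t in ?M. (\<lambda>i. indicator (\<Union>j<i. A j) t *\<^sub>R h t) \<longlonglongrightarrow> indicator (\<Union>j. A j) t *\<^sub>R h t"
          by (intro AE_I2 tendsto_scaleR LIMSEQ_indicator_UN tendsto_const)
      qed (auto simp: indicator_def)
      moreover have "(\<integral>t. indicator (\<Union>j<i. A j) t *\<^sub>R h t \<partial>?M) = 0" for i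
      proof -
        have "(\<integral>t. indicator (\<Union>j<i. A j) t *\<^sub>R h t \<partial>?M) = (\<integral>t. (\<Sum>j<i. indicator (A j) t *\<^sub>R h t) \<partial>?M)"
          using disjoint_family_on_mono[OF subset_UNIV union(1)]
          by (subst indicator_UN_disjoint) (auto simp: scaleR_left.sum)
        also have "\<dots> = (\<Sum>j<i. \<integral>t. indicator (A j) t *\<^sub>R h t \<partial>?M)"
          using A by (intro Bochner_Integration.integral_sum int) auto
        finally show ?thesis using union by simp
      qed
      ultimately show ?case by (simp add: LIMSEQ_const_iff)
    qed
  qed
  show ?thesis
  proof (rule sigma_finite_measure.density_zero[OF _ h])
    interpret finite_measure ?M by (rule finite_measure_lebesgue_on) simp
    show "sigma_finite_measure ?M" by unfold_locales
    fix A assume "A \<in> sets ?M"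
    then have "A \<in> sets lebesgue" "A \<subseteq> {\<alpha>..\<beta>}" by (auto simp: sets_restrict_space_iff)
    then obtain S N N' where SN: "A = S \<union> N" "N \<subseteq> N'" "N' \<in> null_sets lborel" "S \<in> sets lborel"
      by (elim sets_completionE)
    have "set_lebesgue_integral ?M A h = (\<integral>t. indicator S t *\<^sub>R h t \<partial>?M)"
      unfolding set_lebesgue_integral_def
    proof (rule integral_cong_AE)
      show "(\<lambda>t. indicator A t *\<^sub>R h t) \<in> borel_measurable ?M"
        "(\<lambda>t. indicator S t *\<^sub>R h t) \<in> borel_measurable ?M"
        using int[OF \<open>A \<in> sets lebesgue\<close>] int[of S] SN by auto
      have "N' \<inter> {\<alpha>..\<beta>} \<in> null_sets ?M"
        using SN(3) by (auto simp: null_sets_restrict_space intro: null_sets_completionI null_set_Int2)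
      then show "AE t in ?M. indicator A t *\<^sub>R h t = indicator S t *\<^sub>R h t"
        by (rule AE_I') (use SN in \<open>auto simp: indicator_def split: if_splits\<close>)
    qed
    then show "set_lebesgue_integral ?M A h = 0" using borel[of S] SN(4) by simp
  qed
qed

text \<open>The weak derivative is determined almost everywhere by its integrals. It is only locally
  integrable in the open interval, which is therefore exhausted by compact intervals.\<close>

lemma weak_time_derivative_AE_unique:
  fixes w v f :: "real \<Rightarrow> 'b::euclidean_space"
  assumes w: "weak_time_derivative T f w" and f: "continuous_on {0..T} f"
    and v: "integrable (lebesgue_on {0..T}) v"
    and fv: "\<And>a b. 0 \<le> a \<Longrightarrow> a \<le> b \<Longrightarrow> b \<le> T \<Longrightarrow> (\<integral>t. v t \<partial>lebesgue_on {a..b}) = f b - f a"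
  shows "AE t in lebesgue_on {0..T}. w t = v t"
proof -
  have "AE t in lebesgue. t \<in> {\<alpha>..\<beta>} \<longrightarrow> w t = v t" if ab: "0 < \<alpha>" "\<beta> < T" for \<alpha> \<beta>
  proof -
    have w': "integrable (lebesgue_on {\<alpha>..\<beta>}) w"
    proof -
      have "compact {\<alpha>..\<beta>}" "{\<alpha>..\<beta>} \<subseteq> {0<..<T}" using ab by auto
      then show ?thesis
        using w unfolding weak_time_derivative_def weak_partial_def loc_integrable_on_def by blast
    qed
    have v': "integrable (lebesgue_on {\<alpha>..\<beta>}) v"
      by (rule integrable_subinterval[OF v]) (use ab in auto)
    have "AE t in lebesgue_on {\<alpha>..\<beta>}. w t - v t = 0"
    proof (rule AE_eq_0_if_interval_integrals_0)
      show "integrable (lebesgue_on {\<alpha>..\<beta>}) (\<lambda>t. w t - v t)"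
        using w' v' by (rule Bochner_Integration.integrable_diff)
      fix a b assume *: "\<alpha> \<le> a" "a \<le> b" "b \<le> \<beta>"
      then have sub: "{a..b} \<subseteq> {\<alpha>..\<beta>}" by auto
      have "(\<integral>t. w t - v t \<partial>lebesgue_on {a..b}) = (\<integral>t. w t \<partial>lebesgue_on {a..b}) - (\<integral>t. v t \<partial>lebesgue_on {a..b})"
        by (intro Bochner_Integration.integral_diff integrable_subinterval[OF w' sub] integrable_subinterval[OF v' sub])
      also have "(\<integral>t. w t \<partial>lebesgue_on {a..b}) = f b - f a"
        by (rule weak_time_derivative_integral[OF w]) (use * ab in \<open>auto intro: continuous_on_subset[OF f]\<close>)
      also have "(\<integral>t. v t \<partial>lebesgue_on {a..b}) = f b - f a"
        by (rule fv) (use * ab in auto)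
      finally show "(\<integral>t. w t - v t \<partial>lebesgue_on {a..b}) = 0" by simp
    qed
    then show ?thesis by (subst (asm) AE_restrict_space_iff) auto
  qed
  then have "AE t in lebesgue. \<forall>n. t \<in> {1 / real (Suc n)..T - 1 / real (Suc n)} \<longrightarrow> w t = v t"
    unfolding AE_all_countable by auto
  moreover have "AE t in lebesgue. t \<noteq> 0 \<and> t \<noteq> T"
    by (rule AE_I'[where N = "{0, T}"]) (auto intro!: negligible_iff_null_sets[THEN iffD1])
  ultimately have "AE t in lebesgue. t \<in> {0..T} \<longrightarrow> w t = v t"
  proof eventually_elim
    case (elim t)
    show ?case
    proof
      assume "t \<in> {0..T}"
      then have "min t (T - t) > 0" using elim(2) by auto
      then obtain n where "1 / real (Suc n) < min t (T - t)"
        using nat_approx_posE by blast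
      then have "t \<in> {1 / real (Suc n)..T - 1 / real (Suc n)}" by auto
      then show "w t = v t" using elim(1) by blast
    qed
  qed
  then show ?thesis by (subst AE_restrict_space_iff) auto
qed

text \<open>For a function that is continuous up to the endpoints and has an integrable weak derivative, the
  fundamental theorem extends to the closed interval, since both sides depend continuously
  on the limits of integration.\<close>

lemma weak_time_derivative_integral_closed:
  fixes f g :: "real \<Rightarrow> 'b::euclidean_space"
  assumes wd: "weak_time_derivative T f g" and f: "continuous_on {0..T} f"
    and g: "integrable (lebesgue_on {0..T}) g"
    and ab: "0 \<le> a" "a \<le> b" "b \<le> T" and "0 < T"
  shows "(\<integral>t. g t \<partial>lebesgue_on {a..b}) = f b - f a"
proof -
  let ?I = "\<lambda>t. \<integral>s. g s \<partial>lebesgue_on {0..t}"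
  have split: "?I t = ?I s + (\<integral>r. g r \<partial>lebesgue_on {s..t})" if "0 \<le> s" "s \<le> t" "t \<le> T" for s t
    using that
    by (intro Equivalence_Measurable_On_Borel.integral_combine integrable_subinterval[OF g]) auto
  let ?m = "T / 2"
  have const: "f t - ?I t = f ?m - ?I ?m" if "t \<in> {0<..<T}" for t
  proof (cases "t \<le> ?m")
    case True
    have "(\<integral>r. g r \<partial>lebesgue_on {t..?m}) = f ?m - f t"
      by (rule weak_time_derivative_integral[OF wd])
        (use True that \<open>0 < T\<close> in \<open>auto intro: continuous_on_subset[OF f]\<close>)
    then show ?thesis using split[of t ?m] True that \<open>0 < T\<close> by simp
  next
    case False
    have "(\<integral>r. g r \<partial>lebesgue_on {?m..t}) = f t - f ?m"
      by (rule weak_time_derivative_integral[OF wd])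
        (use False that \<open>0 < T\<close> in \<open>auto intro: continuous_on_subset[OF f]\<close>)
    then show ?thesis using split[of ?m t] False that \<open>0 < T\<close> by simp
  qed
  have cl: "closure {0<..<T} = {0..T}" using \<open>0 < T\<close> by simp
  have "f t - ?I t = f ?m - ?I ?m" if "t \<in> {0..T}" for t
  proof (rule continuous_constant_on_closure[where S = "{0<..<T}" and f = "\<lambda>t. f t - ?I t"])
    show "continuous_on (closure {0<..<T}) (\<lambda>t. f t - ?I t)"
      unfolding cl by (intro continuous_on_diff f indefinite_integral_continuous_real[OF g])
    show "t \<in> closure {0<..<T}" unfolding cl by (fact that)
  qed (rule const)
  from this[of a] this[of b] have "f a - ?I a = f b - ?I b" using ab by simp
  then have "f b - f a = ?I b - ?I a" unfolding diff_eq_eq by (simp add: algebra_simps)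
  then show ?thesis using split[of a b] ab by simp
qed

section \<open>Gradient inequalities along curves\<close>

text \<open>Applying the inequality in both directions gives
  \<open>\<bar>S b - S p\<bar> \<le> (\<bar>F b\<bar> + \<bar>F p\<bar>) \<bar>b - p\<bar>\<close>.\<close>

lemma continuous_on_if_subgradient_inequality:
  fixes S :: "'a::real_inner \<Rightarrow> real"
  assumes F: "continuous_on UNIV F" and S: "\<And>a b. S b - S a \<le> F b \<bullet> (b - a)"
  shows "continuous_on UNIV S"
  unfolding continuous_on_eq_continuous_at[OF open_UNIV]
proof
  fix p
  have "(F \<longlongrightarrow> F p) (at p)"
    using F by (simp add: continuous_on_eq_continuous_at isCont_def)
  then have "((\<lambda>b. (norm (F b) + norm (F p)) * norm (b - p)) \<longlongrightarrow> (norm (F p) + norm (F p)) * norm (p - p)) (at p)"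
    by (intro tendsto_intros)
  then have lim: "((\<lambda>b. (norm (F b) + norm (F p)) * norm (b - p)) \<longlongrightarrow> 0) (at p)"
    by simp
  have "norm (S b - S p) \<le> (norm (F b) + norm (F p)) * norm (b - p)" for b
  proof -
    have "F b \<bullet> (b - p) \<le> norm (F b) * norm (b - p)" "F p \<bullet> (p - b) \<le> norm (F p) * norm (b - p)"
      using norm_cauchy_schwarz[of "F b" "b - p"] norm_cauchy_schwarz[of "F p" "p - b"]
      by (simp_all add: norm_minus_commute)
    moreover have "norm (F b) * norm (b - p) \<ge> 0" "norm (F p) * norm (b - p) \<ge> 0" by simp_all
    ultimately show ?thesis
      unfolding real_norm_def abs_le_iff distrib_right using S[of b p] S[of p b] by linarith
  qed
  then have "\<forall>b. norm (S b - S p) \<le> (norm (F b) + norm (F p)) * norm (b - p)" by blast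
  then have "((\<lambda>b. S b - S p) \<longlongrightarrow> 0) (at p)"
    by (rule Lim_null_comparison[OF always_eventually lim])
  then show "isCont S p" unfolding isCont_def by (rule LIM_zero_cancel)
qed

lemma integrable_inner_continuous_left:
  fixes F v :: "real \<Rightarrow> 'b::euclidean_space"
  assumes F: "continuous_on {a..b} F" and v: "integrable (lebesgue_on {a..b}) v"
  shows "integrable (lebesgue_on {a..b}) (\<lambda>t. F t \<bullet> v t)"
proof -
  obtain C where C: "\<And>t. t \<in> {a..b} \<Longrightarrow> norm (F t) \<le> C"
    using compact_imp_bounded[OF compact_continuous_image[OF F compact_Icc]]
    unfolding bounded_iff by blast
  show ?thesis
  proof (rule Bochner_Integration.integrable_bound)
    show "integrable (lebesgue_on {a..b}) (\<lambda>t. C * norm (v t))" using v by simp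
    have "F \<in> borel_measurable (lebesgue_on {a..b})"
      using F by (rule continuous_imp_measurable_on_sets_lebesgue) simp
    then show "(\<lambda>t. F t \<bullet> v t) \<in> borel_measurable (lebesgue_on {a..b})"
      using v by (intro borel_measurable_inner) auto
    show "AE t in lebesgue_on {a..b}. norm (F t \<bullet> v t) \<le> norm (C * norm (v t))"
    proof (rule AE_I2)
      fix t assume "t \<in> space (lebesgue_on {a..b})"
      then have "norm (F t) \<le> C" using C by simp
      then have "norm (F t) * norm (v t) \<le> C * norm (v t)" by (rule mult_right_mono) simp
      then show "norm (F t \<bullet> v t) \<le> norm (C * norm (v t))"
        using Cauchy_Schwarz_ineq2[of "F t" "v t"] by simp
    qed
  qed
qed

text \<open>The substitute for the chain rule. On a partition finer than the modulus of continuity of \<open>F\<close> for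
  \<open>e\<close>, replacing \<open>F b\<close> by \<open>F t\<close> in each interval costs at most \<open>e \<integral> \<bar>v\<bar>\<close> in total.\<close>

lemma increment_le_integral:
  fixes s :: "real \<Rightarrow> real" and F v :: "real \<Rightarrow> 'b::euclidean_space"
  assumes "\<alpha> \<le> \<beta>" and F: "continuous_on {\<alpha>..\<beta>} F" and v: "integrable (lebesgue_on {\<alpha>..\<beta>}) v"
    and step: "\<And>a b. \<alpha> \<le> a \<Longrightarrow> a \<le> b \<Longrightarrow> b \<le> \<beta> \<Longrightarrow> s b - s a \<le> F b \<bullet> (\<integral>t. v t \<partial>lebesgue_on {a..b})"
  shows "s \<beta> - s \<alpha> \<le> (\<integral>t. F t \<bullet> v t \<partial>lebesgue_on {\<alpha>..\<beta>})"
proof -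
  let ?V = "\<integral>t. norm (v t) \<partial>lebesgue_on {\<alpha>..\<beta>}"
  have Fv: "integrable (lebesgue_on {\<alpha>..\<beta>}) (\<lambda>t. F t \<bullet> v t)"
    using F v by (rule integrable_inner_continuous_left)
  have approx: "s \<beta> - s \<alpha> \<le> (\<integral>t. F t \<bullet> v t \<partial>lebesgue_on {\<alpha>..\<beta>}) + e * ?V" if "e > 0" for e
  proof -
    obtain d where d: "d > 0"
      "\<And>t t'. t \<in> {\<alpha>..\<beta>} \<Longrightarrow> t' \<in> {\<alpha>..\<beta>} \<Longrightarrow> dist t' t < d \<Longrightarrow> dist (F t') (F t) < e"
      using compact_uniformly_continuous[OF F compact_Icc] \<open>e > 0\<close>
      unfolding uniformly_continuous_on_def by metis
    define k where "k t = F t \<bullet> v t + e * norm (v t)" for t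
    have k: "integrable (lebesgue_on {\<alpha>..\<beta>}) k"
      unfolding k_def using Fv v by (intro Bochner_Integration.integrable_add) auto
    have local: "s b - s a \<le> (\<integral>t. k t \<partial>lebesgue_on {a..b})"
      if ab: "\<alpha> \<le> a" "a \<le> b" "b \<le> \<beta>" "b - a < d" for a b
    proof -
      have sub: "{a..b} \<subseteq> {\<alpha>..\<beta>}" using ab by auto
      have v': "integrable (lebesgue_on {a..b}) v" and k': "integrable (lebesgue_on {a..b}) k"
        by (rule integrable_subinterval[OF v sub], rule integrable_subinterval[OF k sub])
      have "s b - s a \<le> F b \<bullet> (\<integral>t. v t \<partial>lebesgue_on {a..b})" by (intro step ab)
      also have "\<dots> = (\<integral>t. F b \<bullet> v t \<partial>lebesgue_on {a..b})"
        using v' by simp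
      also have "\<dots> \<le> (\<integral>t. k t \<partial>lebesgue_on {a..b})"
      proof (rule integral_mono)
        show "integrable (lebesgue_on {a..b}) (\<lambda>t. F b \<bullet> v t)" using v' by simp
        show "integrable (lebesgue_on {a..b}) k" by (fact k')
        fix t assume "t \<in> space (lebesgue_on {a..b})"
        then have t: "t \<in> {a..b}" by simp
        then have "dist (F b) (F t) < e" using d(2)[of t b] ab by (auto simp: dist_real_def)
        then have "norm (F b - F t) * norm (v t) \<le> e * norm (v t)"
          by (intro mult_right_mono) (auto simp: dist_norm)
        then have "(F b - F t) \<bullet> v t \<le> e * norm (v t)"
          using norm_cauchy_schwarz[of "F b - F t" "v t"] by linarith
        then show "F b \<bullet> v t \<le> k t" by (simp add: k_def inner_diff_left)
      qed
      finally show ?thesis .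
    qed
    obtain n :: nat where n: "(\<beta> - \<alpha>) / d < real n" using reals_Archimedean2 by blast
    have "n > 0"
    proof (rule ccontr)
      assume "\<not> n > 0"
      moreover have "(\<beta> - \<alpha>) / d \<ge> 0" using \<open>\<alpha> \<le> \<beta>\<close> d by simp
      ultimately show False using n by simp
    qed
    define h where "h = (\<beta> - \<alpha>) / n"
    have h: "h \<ge> 0" "h < d" "real n * h = \<beta> - \<alpha>"
      using \<open>\<alpha> \<le> \<beta>\<close> \<open>n > 0\<close> n d by (auto simp: h_def field_simps)
    have "s (\<alpha> + real i * h) - s \<alpha> \<le> (\<integral>t. k t \<partial>lebesgue_on {\<alpha>..\<alpha> + real i * h})" if "i \<le> n" for i
      using that
    proof (induction i)
      case 0
      then show ?case using local[of \<alpha> \<alpha>] \<open>\<alpha> \<le> \<beta>\<close> d by simp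
    next
      case (Suc i)
      let ?a = "\<alpha> + real i * h" and ?b = "\<alpha> + real (Suc i) * h"
      have "real (Suc i) * h \<le> real n * h" using Suc.prems h(1) by (intro mult_right_mono) auto
      then have b: "?b \<le> \<beta>" using h(3) by simp
      have ab: "\<alpha> \<le> ?a" "?a \<le> ?b" "?b - ?a < d" using h by (auto simp: algebra_simps)
      have "(\<integral>t. k t \<partial>lebesgue_on {\<alpha>..?b}) = (\<integral>t. k t \<partial>lebesgue_on {\<alpha>..?a}) + (\<integral>t. k t \<partial>lebesgue_on {?a..?b})"
        by (rule Equivalence_Measurable_On_Borel.integral_combine)
          (use ab b in \<open>simp_all add: integrable_subinterval[OF k]\<close>)
      then show ?case using Suc local[OF ab(1,2) b ab(3)] by simp
    qed
    from this[of n] have "s \<beta> - s \<alpha> \<le> (\<integral>t. k t \<partial>lebesgue_on {\<alpha>..\<beta>})" using h(3) by simp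
    also have "\<dots> = (\<integral>t. F t \<bullet> v t \<partial>lebesgue_on {\<alpha>..\<beta>}) + e * ?V"
      unfolding k_def using Fv v by (subst Bochner_Integration.integral_add) auto
    finally show ?thesis .
  qed
  have "?V \<ge> 0" by simp
  then have pos: "?V + 1 > 0" by linarith
  show ?thesis
  proof (rule field_le_epsilon)
    fix e :: real assume "e > 0"
    then have "e / (?V + 1) > 0" using pos by (rule divide_pos_pos)
    note approx[OF this]
    moreover have "e / (?V + 1) * ?V \<le> e"
      using \<open>e > 0\<close> pos by (simp add: divide_le_eq algebra_simps)
    ultimately show "s \<beta> - s \<alpha> \<le> (\<integral>t. F t \<bullet> v t \<partial>lebesgue_on {\<alpha>..\<beta>}) + e" by simp
  qed
qed

lemma continuous_eq_0_if_interval_integrals_0: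
  fixes h :: "real \<Rightarrow> real"
  assumes h: "continuous_on {a..b} h" and t: "t \<in> {a..b}" "a < b"
    and zero: "\<And>c. a \<le> c \<Longrightarrow> c \<le> b \<Longrightarrow> (\<integral>t. h t \<partial>lebesgue_on {a..c}) = 0"
  shows "h t = 0"
proof -
  have "integral {a..c} h = 0" if "c \<in> {a..b}" for c
  proof -
    have "continuous_on {a..c} h" using that by (intro continuous_on_subset[OF h]) auto
    then have "integrable (lebesgue_on {a..c}) h" by (rule continuous_imp_integrable_real)
    then have "(\<integral>t. h t \<partial>lebesgue_on {a..c}) = integral {a..c} h"
      by (rule lebesgue_integral_eq_integral) simp
    then show ?thesis using zero[of c] that by simp
  qed
  then have "((\<lambda>c. integral {a..c} h) has_vector_derivative 0) (at t within {a..b})"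
    by (intro has_vector_derivative_transform[OF t(1) _ has_vector_derivative_const])
  moreover have "((\<lambda>c. integral {a..c} h) has_vector_derivative h t) (at t within {a..b})"
    by (rule integral_has_vector_derivative[OF h t(1)])
  ultimately show ?thesis
    using vector_derivative_unique_within_closed_interval[of a b t] t by (auto simp flip: box_real)
qed

lemma L2_on_integrable:
  fixes f :: "'a::euclidean_space \<Rightarrow> 'b::euclidean_space"
  assumes f: "L2_on S f" and S: "S \<in> lmeasurable"
  shows "integrable (lebesgue_on S) f"
proof (rule Bochner_Integration.integrable_bound)
  interpret finite_measure "lebesgue_on S" using S by (rule finite_measure_lebesgue_on)
  show "integrable (lebesgue_on S) (\<lambda>x. 1 + (norm (f x))\<^sup>2)"
    using f unfolding L2_on_def by (intro Bochner_Integration.integrable_add) auto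
  show "f \<in> borel_measurable (lebesgue_on S)" using f unfolding L2_on_def by simp
  show "AE x in lebesgue_on S. norm (f x) \<le> norm (1 + (norm (f x))\<^sup>2)"
  proof (rule AE_I2)
    fix x
    have "0 \<le> (norm (f x) - 1)\<^sup>2" by simp
    then have "2 * norm (f x) \<le> 1 + (norm (f x))\<^sup>2" by (simp add: power2_diff)
    then have "norm (f x) \<le> 1 + (norm (f x))\<^sup>2" using norm_ge_zero[of "f x"] by linarith
    then show "norm (f x) \<le> norm (1 + (norm (f x))\<^sup>2)" by simp
  qed
qed

lemma L2_on_integrable_inner:
  fixes f g :: "'a::euclidean_space \<Rightarrow> 'b::euclidean_space"
  assumes "L2_on S f" "L2_on S g"
  shows "integrable (lebesgue_on S) (\<lambda>x. f x \<bullet> g x)"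
proof (rule Bochner_Integration.integrable_bound)
  show "integrable (lebesgue_on S) (\<lambda>x. (norm (f x))\<^sup>2 + (norm (g x))\<^sup>2)"
    using assms unfolding L2_on_def by (intro Bochner_Integration.integrable_add) auto
  show "(\<lambda>x. f x \<bullet> g x) \<in> borel_measurable (lebesgue_on S)"
    using assms unfolding L2_on_def by (intro borel_measurable_inner) auto
  show "AE x in lebesgue_on S. norm (f x \<bullet> g x) \<le> norm ((norm (f x))\<^sup>2 + (norm (g x))\<^sup>2)"
  proof (rule AE_I2)
    fix x
    have "0 \<le> (norm (f x) - norm (g x))\<^sup>2" by simp
    then have "2 * (norm (f x) * norm (g x)) \<le> (norm (f x))\<^sup>2 + (norm (g x))\<^sup>2"
      by (simp add: power2_diff)
    moreover have "0 \<le> norm (f x) * norm (g x)" by simp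
    ultimately have "norm (f x) * norm (g x) \<le> (norm (f x))\<^sup>2 + (norm (g x))\<^sup>2" by linarith
    then show "norm (f x \<bullet> g x) \<le> norm ((norm (f x))\<^sup>2 + (norm (g x))\<^sup>2)"
      using Cauchy_Schwarz_ineq2[of "f x" "g x"] by simp
  qed
qed

section \<open>Passivity of monotone gradient systems\<close>

lemma inner_matrix_vector_mult: "x \<bullet> (A *v y) = (transpose A *v x) \<bullet> y" for A :: "real^'n^'m"
  by (simp add: dot_lmul_matrix[symmetric])

text \<open>This keeps products with a transposed matrix in the form \<open>transpose A *v x\<close> of the output
  equation and of the preceding identity.\<close>

declare transpose_matrix_vector [simp del]

lemma spd_matrix_inv:
  assumes R: "spd (R :: real^'m^'m)"
  shows "transpose (matrix_inv R) = matrix_inv R" "v \<noteq> 0 \<Longrightarrow> v \<bullet> (matrix_inv R *v v) > 0"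
proof -
  have "\<forall>x. R *v x = 0 \<longrightarrow> x = 0"
    using R unfolding spd_def by (metis inner_zero_right less_irrefl)
  then have inv: "invertible R"
    by (simp add: invertible_left_inverse matrix_left_invertible_ker)
  have inv1: "R ** matrix_inv R = mat 1"
    using someI_ex[OF inv[unfolded invertible_def]] unfolding matrix_inv_def by (rule conjunct1)
  have "transpose (matrix_inv R) ** R = mat 1"
    using arg_cong[OF inv1, of transpose] R by (simp add: matrix_transpose_mul spd_def)
  then have "transpose (matrix_inv R) ** (R ** matrix_inv R) = matrix_inv R"
    by (simp add: matrix_mul_assoc)
  then show "transpose (matrix_inv R) = matrix_inv R" by (simp add: inv1)
  assume "v \<noteq> 0"
  let ?w = "matrix_inv R *v v"
  have "R *v ?w = v" by (simp add: matrix_vector_mul_assoc inv1)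
  then have "?w \<noteq> 0" using \<open>v \<noteq> 0\<close> by auto
  then have "?w \<bullet> (R *v ?w) > 0" using R unfolding spd_def by blast
  then show "v \<bullet> (matrix_inv R *v v) > 0" using \<open>R *v ?w = v\<close> by (simp add: inner_commute)
qed

text \<open>The component of \<open>y\<close> orthogonal to the range lies in the kernel by symmetry, hence is orthogonal
  to \<open>y\<close>, hence is 0.\<close>

lemma symmetric_range_if_orthogonal_kernel:
  fixes E :: "real^'n^'n"
  assumes E: "transpose E = E" and y: "\<And>z. E *v z = 0 \<Longrightarrow> z \<bullet> y = 0"
  shows "y \<in> range (\<lambda>x. E *v x)"
proof -
  have sub: "subspace (range (\<lambda>x. E *v x))"
    by (rule linear_subspace_image) simp_all
  obtain p q where p: "p \<in> span (range (\<lambda>x. E *v x))"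
    and q: "\<And>w. w \<in> span (range (\<lambda>x. E *v x)) \<Longrightarrow> orthogonal q w" and pq: "y = p + q"
    by (rule orthogonal_subspace_decomp_exists[of "range (\<lambda>x. E *v x)" y]) blast
  have "(E *v q) \<bullet> w = 0" for w
  proof -
    have "q \<bullet> (E *v w) = 0"
      using q[OF span_base[OF rangeI[of _ w]]] unfolding orthogonal_def .
    then show ?thesis using inner_matrix_vector_mult[of q E w] unfolding E by metis
  qed
  from this[of "E *v q"] have "E *v q = 0" by (simp only: inner_eq_zero_iff)
  then have "q \<bullet> y = 0" using y by simp
  moreover have "q \<bullet> p = 0" using q[OF p] by (simp add: orthogonal_def)
  ultimately have "q \<bullet> q = 0" by (simp add: pq inner_add_right)
  then show ?thesis using p pq span_eq_iff[THEN iffD2, OF sub] by simp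
qed

lemma transpose_add: "transpose (A + B) = transpose A + transpose B" for A B :: "real^'n^'m"
  by (simp add: transpose_def vec_eq_iff)

text \<open>The passivity argument for a possibly singular \<open>E\<close>: the inequality for \<open>S\<close> and \<open>F\<close> expresses
  that \<open>F\<close> is the gradient of the convex function \<open>S\<close>, and it is used in this form because the state itself need
  not be differentiable.\<close>

lemma monotone_gradient_system_passive:
  fixes E D :: "real^'n^'n" and N :: "real^'m^'n" and R :: "real^'m^'m"
    and F :: "real^'n \<Rightarrow> real^'n" and S :: "real^'n \<Rightarrow> real"
  assumes R: "spd R"
    and D: "transpose D = D" "\<And>v. v \<bullet> (D *v v) \<ge> 0"
    and E: "E = D + N ** matrix_inv R ** transpose N" and B: "B = N ** matrix_inv R"
    and F: "continuous_on UNIV F"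
    and S: "\<And>x. S x \<ge> 0" "\<And>a b. S b - S a \<le> F b \<bullet> (b - a)"
  shows "passive_system E (\<lambda>x. - F x) B (mqs_output B R)"
proof -
  let ?P = "matrix_inv R"
  note P = spd_matrix_inv[OF R]
  have P_nonneg: "v \<bullet> (?P *v v) \<ge> 0" for v
    using P(2)[of v] by (cases "v = 0") auto
  have BT: "transpose B *v x = ?P *v (transpose N *v x)" for x
    by (simp add: B matrix_transpose_mul P(1) matrix_vector_mul_assoc)
  have E_apply: "E *v x = D *v x + N *v (?P *v (transpose N *v x))" for x
    by (simp add: E matrix_vector_mult_add_rdistrib matrix_vector_mul_assoc matrix_mul_assoc)
  have N_inner: "x \<bullet> (N *v y) = (transpose N *v x) \<bullet> y" for x y
    by (rule inner_matrix_vector_mult)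
  have E_sym: "transpose E = E"
    by (simp add: E D(1) transpose_add matrix_transpose_mul P(1) matrix_mul_assoc)
  have E_form: "x \<bullet> (E *v x) = x \<bullet> (D *v x) + (transpose N *v x) \<bullet> (?P *v (transpose N *v x))" for x
    by (simp add: E_apply inner_add_right N_inner)
  \<comment> \<open>Positive definiteness of \<open>P\<close> makes the input matrix invisible on the kernel of \<open>E\<close>.\<close>
  have ker: "transpose B *v z = 0" if "E *v z = 0" for z
  proof -
    have "(transpose N *v z) \<bullet> (?P *v (transpose N *v z)) \<le> 0"
      using E_form[of z] that D(2)[of z] by simp
    then have "transpose N *v z = 0" using P(2)[of "transpose N *v z"] by force
    then show ?thesis by (simp add: BT)
  qed
  obtain G where G: "linear G" "\<And>y. y \<in> range (\<lambda>x. E *v x) \<Longrightarrow> E *v G y = y"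
    using linear_exists_right_inverse_on[OF matrix_vector_mul_linear[of E] subspace_UNIV] by blast
  have G_ker: "E *v (x - G (E *v x)) = 0" for x
    using G(2)[of "E *v x"] by (simp add: matrix_vector_mult_diff_distrib)
  have G_bl: "bounded_linear G" using G(1) by (rule linear_linear[THEN iffD2])
  have S_cont: "continuous_on UNIV S"
    using F S(2) by (rule continuous_on_if_subgradient_inequality)
  have dissipation: "continuous_on {0..T} (\<lambda>t. S (x t))"
    "\<And>t0 t1. 0 \<le> t0 \<Longrightarrow> t0 \<le> t1 \<Longrightarrow> t1 \<le> T \<Longrightarrow> S (x t1) - S (x t0) \<le> (\<integral>\<tau>. u \<tau> \<bullet> y \<tau> \<partial>lebesgue_on {t0..t1})"
    if T: "T > 0" and u: "L2_on {0..T} u"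
      and traj: "trajectory E (\<lambda>x. - F x) B (mqs_output B R) T x0 u x y" for T x0 u x y
  proof -
    from traj obtain w where x: "continuous_on {0..T} x"
      and wd: "weak_time_derivative T (\<lambda>t. E *v x t) (\<lambda>t. - F (x t) + B *v u t)"
      and w: "weak_time_derivative T (\<lambda>t. transpose B *v x t) w"
      and yw: "AE t in lebesgue_on {0..T}. y t = - w t + ?P *v u t"
      and y: "L2_on {0..T} y"
      unfolding trajectory_def mqs_output_def by blast
    show "continuous_on {0..T} (\<lambda>t. S (x t))"
      by (rule continuous_on_compose2[OF S_cont x]) simp
    have Fx: "continuous_on {0..T} (\<lambda>t. F (x t))"
      by (rule continuous_on_compose2[OF F x]) simp
    define g where "g t = - F (x t) + B *v u t" for t
    have u_int: "integrable (lebesgue_on {0..T}) u"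
      using u by (rule L2_on_integrable) simp
    have g_int: "integrable (lebesgue_on {0..T}) g"
      unfolding g_def
      by (intro Bochner_Integration.integrable_add Bochner_Integration.integrable_minus
          continuous_imp_integrable_real[OF Fx] integrable_bounded_linear[OF matrix_vector_mul_bounded_linear u_int])
    have Ex: "continuous_on {0..T} (\<lambda>t. E *v x t)"
      by (intro linear_continuous_on_compose[OF x]) simp
    have int_g: "(\<integral>t. g t \<partial>lebesgue_on {a..b}) = E *v x b - E *v x a"
      if "0 \<le> a" "a \<le> b" "b \<le> T" for a b
      using weak_time_derivative_integral_closed[OF wd Ex _ that T] g_int unfolding g_def by blast
    \<comment> \<open>Pairing the integrated state equation with \<open>z\<close> removes both \<open>E x\<close> and \<open>B u\<close>.\<close>
    have F_ker: "z \<bullet> F (x t) = 0" if z: "E *v z = 0" and t: "t \<in> {0..T}" for z t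
    proof -
      have "continuous_on {0..T} (\<lambda>t. z \<bullet> F (x t))" using Fx by (intro continuous_intros)
      then show ?thesis
      proof (rule continuous_eq_0_if_interval_integrals_0[OF _ t T])
        fix c assume c: "0 \<le> c" "c \<le> T"
        have "z \<bullet> (B *v v) = 0" for v
          using ker[OF z] by (simp add: inner_matrix_vector_mult[of z B v])
        then have "z \<bullet> F (x t) = - (z \<bullet> g t)" for t
          by (simp add: g_def inner_diff_right)
        then have "(\<integral>t. z \<bullet> F (x t) \<partial>lebesgue_on {0..c}) = (\<integral>t. - (z \<bullet> g t) \<partial>lebesgue_on {0..c})"
          by simp
        also have "\<dots> = - (z \<bullet> (\<integral>t. g t \<partial>lebesgue_on {0..c}))"
          using integrable_subinterval[OF g_int, of 0 c] c by simp
        also have "z \<bullet> (\<integral>t. g t \<partial>lebesgue_on {0..c}) = z \<bullet> (E *v (x c - x 0))"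
          using c by (simp add: int_g matrix_vector_mult_diff_distrib)
        also have "\<dots> = 0"
          using z E_sym inner_matrix_vector_mult[of z E "x c - x 0"] by simp
        finally show "(\<integral>t. z \<bullet> F (x t) \<partial>lebesgue_on {0..c}) = 0" by simp
      qed
    qed
    \<comment> \<open>\<open>v\<close> plays the role of the derivative of the state; it is one modulo the kernel of \<open>E\<close>.\<close>
    define v where "v t = G (g t)" for t
    have v_int: "integrable (lebesgue_on {0..T}) v"
      unfolding v_def by (rule integrable_bounded_linear[OF G_bl g_int])
    have int_v: "(\<integral>t. v t \<partial>lebesgue_on {a..b}) = G (E *v (x b - x a))"
      if "0 \<le> a" "a \<le> b" "b \<le> T" for a b
    proof -
      have "integrable (lebesgue_on {a..b}) g"
        using that by (intro integrable_subinterval[OF g_int]) auto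
      then have "(\<integral>t. v t \<partial>lebesgue_on {a..b}) = G (\<integral>t. g t \<partial>lebesgue_on {a..b})"
        unfolding v_def by (rule integral_bounded_linear[OF G_bl])
      then show ?thesis using int_g[OF that] by (simp add: matrix_vector_mult_diff_distrib)
    qed
    have Ev: "E *v v t = - F (x t) + B *v u t" if t: "t \<in> {0..T}" for t
    proof -
      have "z \<bullet> g t = 0" if "E *v z = 0" for z
        using F_ker[OF that t] ker[OF that]
        by (simp add: g_def inner_diff_right inner_matrix_vector_mult[of z B "u t"])
      then have "g t \<in> range (\<lambda>x. E *v x)"
        by (rule symmetric_range_if_orthogonal_kernel[OF E_sym])
      then show ?thesis unfolding v_def g_def[symmetric] by (rule G(2))
    qed
    \<comment> \<open>The output sees only \<open>B\<^sup>T x\<close>, which is insensitive to the kernel component of the state.\<close>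
    have w_eq: "AE t in lebesgue_on {0..T}. w t = transpose B *v v t"
    proof (rule weak_time_derivative_AE_unique[OF w])
      show "continuous_on {0..T} (\<lambda>t. transpose B *v x t)"
        by (intro linear_continuous_on_compose[OF x]) simp
      show "integrable (lebesgue_on {0..T}) (\<lambda>t. transpose B *v v t)"
        by (rule integrable_bounded_linear[OF matrix_vector_mul_bounded_linear v_int])
      fix a b assume ab: "0 \<le> a" "a \<le> b" "b \<le> T"
      have "integrable (lebesgue_on {a..b}) v"
        using ab by (intro integrable_subinterval[OF v_int]) auto
      then have "(\<integral>t. transpose B *v v t \<partial>lebesgue_on {a..b}) = transpose B *v (\<integral>t. v t \<partial>lebesgue_on {a..b})"
        by (rule integral_bounded_linear[OF matrix_vector_mul_bounded_linear])
      also have "\<dots> = transpose B *v (x b - x a)"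
        using ker[OF G_ker[of "x b - x a"]] by (simp add: int_v[OF ab] matrix_vector_mult_diff_distrib)
      finally show "(\<integral>t. transpose B *v v t \<partial>lebesgue_on {a..b}) = transpose B *v x b - transpose B *v x a"
        by (simp add: matrix_vector_mult_diff_distrib)
    qed
    \<comment> \<open>The gap is \<open>v \<bullet> D v + (u - q) \<bullet> P (u - q)\<close> with \<open>q = N\<^sup>T v\<close>.\<close>
    have power_balance: "AE t in lebesgue_on {0..T}. F (x t) \<bullet> v t \<le> u t \<bullet> y t"
      using yw w_eq AE_space
    proof eventually_elim
      case (elim t)
      let ?q = "transpose N *v v t"
      have "F (x t) = B *v u t - E *v v t" using Ev[of t] elim(3) by simp
      then have "F (x t) \<bullet> v t = v t \<bullet> (B *v u t) - v t \<bullet> (E *v v t)"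
        by (simp add: inner_diff_right inner_commute[of _ "v t"])
      also have "v t \<bullet> (B *v u t) = ?q \<bullet> (?P *v u t)"
        by (simp add: B N_inner flip: matrix_vector_mul_assoc)
      finally have Fv: "F (x t) \<bullet> v t = ?q \<bullet> (?P *v u t) - v t \<bullet> (D *v v t) - ?q \<bullet> (?P *v ?q)"
        by (simp add: E_form)
      have uq: "u t \<bullet> (?P *v ?q) = ?q \<bullet> (?P *v u t)"
        using inner_matrix_vector_mult[of "u t" ?P ?q] by (simp add: P(1) inner_commute)
      have "u t \<bullet> y t = u t \<bullet> (?P *v u t) - ?q \<bullet> (?P *v u t)"
        using elim(1,2) by (simp add: BT inner_diff_right uq)
      moreover have "0 \<le> (u t - ?q) \<bullet> (?P *v (u t - ?q))" by (rule P_nonneg)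
      then have "0 \<le> u t \<bullet> (?P *v u t) - 2 * (?q \<bullet> (?P *v u t)) + ?q \<bullet> (?P *v ?q)"
        using uq by (simp add: matrix_vector_mult_diff_distrib inner_diff_left inner_diff_right)
      ultimately show ?case using Fv D(2)[of "v t"] by linarith
    qed
    fix t0 t1 assume t: "0 \<le> t0" "t0 \<le> t1" "t1 \<le> T"
    have sub: "{t0..t1} \<subseteq> {0..T}" using t by auto
    have Fx': "continuous_on {t0..t1} (\<lambda>t. F (x t))" using Fx sub by (rule continuous_on_subset)
    have v': "integrable (lebesgue_on {t0..t1}) v" using v_int sub by (rule integrable_subinterval)
    have "S (x t1) - S (x t0) \<le> (\<integral>t. F (x t) \<bullet> v t \<partial>lebesgue_on {t0..t1})"
    proof (rule increment_le_integral[OF t(2) Fx' v'])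
      fix a b assume ab: "t0 \<le> a" "a \<le> b" "b \<le> t1"
      have "S (x b) - S (x a) \<le> F (x b) \<bullet> (x b - x a)" by (rule S(2))
      also have "\<dots> = F (x b) \<bullet> G (E *v (x b - x a))"
        using F_ker[OF G_ker[of "x b - x a"], of b] ab t by (simp add: inner_diff_right inner_commute)
      also have "G (E *v (x b - x a)) = (\<integral>t. v t \<partial>lebesgue_on {a..b})"
        by (rule int_v[symmetric]) (use ab t in auto)
      finally show "S (x b) - S (x a) \<le> F (x b) \<bullet> (\<integral>t. v t \<partial>lebesgue_on {a..b})" .
    qed
    also have "\<dots> \<le> (\<integral>t. u t \<bullet> y t \<partial>lebesgue_on {t0..t1})"
    proof (rule integral_mono_AE)
      show "integrable (lebesgue_on {t0..t1}) (\<lambda>t. F (x t) \<bullet> v t)"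
        using Fx' v' by (rule integrable_inner_continuous_left)
      show "integrable (lebesgue_on {t0..t1}) (\<lambda>t. u t \<bullet> y t)"
        by (rule integrable_subinterval[OF L2_on_integrable_inner[OF u y] sub])
      show "AE t in lebesgue_on {t0..t1}. F (x t) \<bullet> v t \<le> u t \<bullet> y t"
        using power_balance sub by (auto simp: AE_restrict_space_iff elim!: eventually_mono)
    qed
    finally show "S (x t1) - S (x t0) \<le> (\<integral>\<tau>. u \<tau> \<bullet> y \<tau> \<partial>lebesgue_on {t0..t1})" .
  qed
  have "storage_function E (\<lambda>x. - F x) B (mqs_output B R) (\<lambda>x. ennreal (S x))"
    unfolding storage_function_def admissible_input_def
    using dissipation by (auto simp: S(1) enn2ereal_ennreal intro!: continuous_on_ennreal)
  then show ?thesis unfolding passive_system_def by (auto intro!: exI[of _ "\<lambda>x. ennreal (S x)"])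
qed

section \<open>The magnetic energy\<close>

lemma admissible_reluctivity_flux:
  assumes "admissible_reluctivity \<nu>C m L"
  shows "continuous_on {0..} (\<lambda>\<zeta>. \<nu>C \<zeta> * \<zeta>)"
    and "\<And>\<zeta> \<eta>. 0 \<le> \<zeta> \<Longrightarrow> \<zeta> \<le> \<eta> \<Longrightarrow> \<nu>C \<zeta> * \<zeta> \<le> \<nu>C \<eta> * \<eta>"
    and "\<And>\<zeta>. \<zeta> \<ge> 0 \<Longrightarrow> 0 \<le> \<nu>C \<zeta>" and "\<And>\<zeta>. \<zeta> \<ge> 0 \<Longrightarrow> \<nu>C \<zeta> * \<zeta> \<le> L * \<zeta>" and "L > 0"
proof -
  from assms have lip: "L-lipschitz_on {0..} (\<lambda>\<zeta>. \<nu>C \<zeta> * \<zeta>)" and "L > 0" and "m > 0"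
    and nonneg: "\<And>\<zeta>. \<zeta> \<ge> 0 \<Longrightarrow> 0 \<le> \<nu>C \<zeta>"
    and mono: "\<And>\<zeta> \<eta>. \<zeta> \<ge> 0 \<Longrightarrow> \<eta> \<ge> 0 \<Longrightarrow> (\<nu>C \<zeta> * \<zeta> - \<nu>C \<eta> * \<eta>) * (\<zeta> - \<eta>) \<ge> m * (\<zeta> - \<eta>)\<^sup>2"
    unfolding admissible_reluctivity_def by auto
  show "L > 0" by fact
  show "0 \<le> \<nu>C \<zeta>" if "\<zeta> \<ge> 0" for \<zeta> using nonneg that .
  show "continuous_on {0..} (\<lambda>\<zeta>. \<nu>C \<zeta> * \<zeta>)"
    using lip by (rule lipschitz_on_continuous_on)
  show "\<nu>C \<zeta> * \<zeta> \<le> \<nu>C \<eta> * \<eta>" if "0 \<le> \<zeta>" "\<zeta> \<le> \<eta>" for \<zeta> \<eta>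
  proof (cases "\<zeta> = \<eta>")
    case False
    have "0 \<le> m * (\<eta> - \<zeta>)\<^sup>2" using \<open>m > 0\<close> by simp
    also have "\<dots> \<le> (\<nu>C \<eta> * \<eta> - \<nu>C \<zeta> * \<zeta>) * (\<eta> - \<zeta>)" using mono[of \<eta> \<zeta>] that by simp
    finally show ?thesis using False that by (simp add: zero_le_mult_iff)
  qed simp
  show "\<nu>C \<zeta> * \<zeta> \<le> L * \<zeta>" if "\<zeta> \<ge> 0" for \<zeta>
    using lipschitz_onD[OF lip, of \<zeta> 0] that by (simp add: dist_real_def)
qed

text \<open>The potential is \<open>W z = J \<bar>z\<bar>\<close> with \<open>J \<zeta> = \<integral>\<^sub>0\<^sup>\<zeta> \<nu>(s) s ds\<close>. The scalar gradient inequality follows from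
  monotonicity of the integrand, and it passes to vectors by the Cauchy-Schwarz inequality, where
  \<open>\<nu> \<ge> 0\<close> is needed.\<close>

lemma radial_potential_exists:
  fixes \<nu> :: "real \<Rightarrow> real"
  assumes cont: "continuous_on {0..} (\<lambda>\<zeta>. \<nu> \<zeta> * \<zeta>)"
    and mono: "\<And>\<zeta> \<eta>. 0 \<le> \<zeta> \<Longrightarrow> \<zeta> \<le> \<eta> \<Longrightarrow> \<nu> \<zeta> * \<zeta> \<le> \<nu> \<eta> * \<eta>"
    and nonneg: "\<And>\<zeta>. \<zeta> \<ge> 0 \<Longrightarrow> 0 \<le> \<nu> \<zeta>"
  shows "\<exists>W :: 'a::real_inner \<Rightarrow> real. (\<forall>a. W a \<ge> 0)
    \<and> (\<forall>a b. W b - W a \<le> (\<nu> (norm b) *\<^sub>R b) \<bullet> (b - a))"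
proof (intro exI conjI allI)
  define h where "h \<zeta> = \<nu> \<zeta> * \<zeta>" for \<zeta>
  define J where "J \<zeta> = integral {0..\<zeta>} h" for \<zeta>
  have int: "h integrable_on {a..b}" if "0 \<le> a" for a b
    by (rule integrable_continuous_interval, rule continuous_on_subset[of "{0..}"])
      (use that cont in \<open>auto simp: h_def[abs_def]\<close>)
  have J_diff: "J b - J a = integral {a..b} h" if "0 \<le> a" "a \<le> b" for a b
    using Henstock_Kurzweil_Integration.integral_combine[OF that int] by (simp add: J_def)
  have J: "J b - J a \<le> h b * (b - a)" if ab: "a \<ge> 0" "b \<ge> 0" for a b
  proof (cases "a \<le> b")
    case True
    have "integral {a..b} h \<le> integral {a..b} (\<lambda>_. h b)"
      by (rule integral_le) (use ab True mono int in \<open>auto simp: h_def\<close>)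
    then show ?thesis using J_diff[OF ab(1) True] True by (simp add: mult.commute)
  next
    case False
    have "integral {b..a} (\<lambda>_. h b) \<le> integral {b..a} h"
      by (rule integral_le) (use ab False mono int in \<open>auto simp: h_def\<close>)
    then show ?thesis using J_diff[OF ab(2), of a] False by (simp add: algebra_simps)
  qed
  show "J (norm a) \<ge> 0" for a :: 'a
    unfolding J_def by (rule integral_nonneg[OF int]) (auto simp: h_def nonneg)
  show "J (norm b) - J (norm a) \<le> (\<nu> (norm b) *\<^sub>R b) \<bullet> (b - a)" for a b :: 'a
  proof -
    have "J (norm b) - J (norm a) \<le> h (norm b) * (norm b - norm a)" by (rule J) auto
    also have "\<dots> = \<nu> (norm b) * (norm b * norm b - norm b * norm a)"
      by (simp add: h_def algebra_simps)
    also have "\<dots> \<le> \<nu> (norm b) * (b \<bullet> b - b \<bullet> a)"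
      using norm_cauchy_schwarz[of b a]
      by (intro mult_left_mono nonneg) (auto simp: dot_square_norm power2_eq_square)
    finally show ?thesis by (simp add: inner_diff_right right_diff_distrib)
  qed
qed

text \<open>Only \<open>\<nu>(\<zeta>) \<zeta>\<close> is continuous, while \<open>\<nu>\<close> itself may be discontinuous at 0; there the flux is
  controlled by its linear growth.\<close>

lemma continuous_on_radial_flux:
  fixes \<nu> :: "real \<Rightarrow> real" and b :: "'a::real_inner"
  assumes cont: "continuous_on {0..} (\<lambda>\<zeta>. \<nu> \<zeta> * \<zeta>)"
    and nonneg: "\<And>\<zeta>. \<zeta> \<ge> 0 \<Longrightarrow> 0 \<le> \<nu> \<zeta>" and L: "\<And>\<zeta>. \<zeta> \<ge> 0 \<Longrightarrow> \<nu> \<zeta> * \<zeta> \<le> L * \<zeta>"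
  shows "continuous_on UNIV (\<lambda>b::'a. \<nu> (norm b) *\<^sub>R b)" (is "continuous_on _ ?Q")
    and "norm (\<nu> (norm b) *\<^sub>R b) \<le> L * norm b"
proof -
  have bound: "norm (\<nu> (norm b) *\<^sub>R b) \<le> L * norm b" for b :: 'a
    using L[of "norm b"] nonneg[of "norm b"] by simp
  then show "norm (\<nu> (norm b) *\<^sub>R b) \<le> L * norm b" .
  have "isCont ?Q p" for p
  proof (cases "p = 0")
    case True
    have "isCont (\<lambda>b::'a. L * norm b) 0" by (intro continuous_intros)
    then have "((\<lambda>b. L * norm b) \<longlongrightarrow> 0) (at (0::'a))" by (simp add: isCont_def)
    then have "(?Q \<longlongrightarrow> 0) (at 0)"
      by (rule Lim_null_comparison[rotated]) (rule always_eventually, rule allI, rule bound)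
    then show ?thesis using True by (simp add: isCont_def)
  next
    case False
    have "continuous_on (- {0}) (\<lambda>b::'a. (\<nu> (norm b) * norm b / norm b) *\<^sub>R b)"
      by (intro continuous_intros continuous_on_compose2[OF cont]) auto
    then have "continuous_on (- {0}) ?Q"
      by (rule continuous_on_eq) auto
    then show ?thesis using False
      by (simp add: continuous_on_eq_continuous_at open_Compl)
  qed
  then show "continuous_on UNIV ?Q" by (simp add: continuous_on_eq_continuous_at)
qed

text \<open>Convexity and differentiability of an integral functional follow from those of its density \<open>W\<close>: the
  pointwise gradient inequality is integrated, and the gradient \<open>F\<close> is continuous by dominated
  convergence.\<close>

lemma integral_functional_gradient:
  fixes g :: "'e::finite \<Rightarrow> 'x \<Rightarrow> 'v::euclidean_space" and Q :: "'v \<Rightarrow> 'v" and W :: "'v \<Rightarrow> real"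
  assumes M: "finite_measure M" and g: "\<And>j. g j \<in> borel_measurable M"
    and bound: "\<And>j x. norm (g j x) \<le> C"
    and Q: "continuous_on UNIV Q" "\<And>z. norm (Q z) \<le> L * norm z"
    and W: "\<And>z. W z \<ge> 0" "\<And>z z'. W z' - W z \<le> Q z' \<bullet> (z' - z)"
  defines "G \<equiv> \<lambda>(a::real^'e) x. \<Sum>j\<in>UNIV. a $ j *\<^sub>R g j x"
  defines "S \<equiv> \<lambda>a. \<integral>x. W (G a x) \<partial>M"
    and "F \<equiv> \<lambda>a. \<chi> k. \<integral>x. Q (G a x) \<bullet> g k x \<partial>M"
  shows "S a \<ge> 0" "S b - S a \<le> F b \<bullet> (b - a)" "continuous_on UNIV F"
    "integrable M (\<lambda>x. Q (G a x) \<bullet> g k x)"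
proof -
  interpret finite_measure M by (rule M)
  have C: "C \<ge> 0" using bound norm_ge_zero order_trans by blast
  have L: "L * norm z \<ge> 0" for z :: 'v using Q(2)[of z] norm_ge_zero order_trans by blast
  have W_cont: "continuous_on UNIV W" using Q(1) W(2) by (rule continuous_on_if_subgradient_inequality)
  have G_meas: "G a \<in> borel_measurable M" for a
    unfolding G_def using g by measurable
  have G_bound: "norm (G a x) \<le> (\<Sum>j\<in>UNIV. \<bar>a $ j\<bar>) * C" for a x
  proof -
    have "norm (G a x) \<le> (\<Sum>j\<in>UNIV. norm (a $ j *\<^sub>R g j x))" unfolding G_def by (rule norm_sum)
    also have "\<dots> \<le> (\<Sum>j\<in>UNIV. \<bar>a $ j\<bar> * C)"
      using bound by (intro sum_mono) (auto intro: mult_left_mono)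
    finally show ?thesis by (simp add: sum_distrib_right)
  qed
  have QG_meas: "(\<lambda>x. Q (G a x) \<bullet> g k x) \<in> borel_measurable M" for a k
    by (intro borel_measurable_inner g measurable_compose[OF G_meas] borel_measurable_continuous_onI Q(1))
  have QG_bound: "norm (Q (G a x) \<bullet> g k x) \<le> \<bar>L\<bar> * ((\<Sum>j\<in>UNIV. \<bar>a $ j\<bar>) * C) * C" for a k x
  proof -
    have "norm (Q (G a x) \<bullet> g k x) \<le> norm (Q (G a x)) * norm (g k x)"
      using Cauchy_Schwarz_ineq2 by simp
    also have "\<dots> \<le> (\<bar>L\<bar> * ((\<Sum>j\<in>UNIV. \<bar>a $ j\<bar>) * C)) * C"
    proof (rule mult_mono)
      have "norm (Q (G a x)) \<le> L * norm (G a x)" by (rule Q(2))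
      also have "\<dots> \<le> \<bar>L\<bar> * norm (G a x)" by (rule mult_right_mono) auto
      also have "\<dots> \<le> \<bar>L\<bar> * ((\<Sum>j\<in>UNIV. \<bar>a $ j\<bar>) * C)" by (rule mult_left_mono[OF G_bound]) simp
      finally show "norm (Q (G a x)) \<le> \<bar>L\<bar> * ((\<Sum>j\<in>UNIV. \<bar>a $ j\<bar>) * C)" .
      show "0 \<le> \<bar>L\<bar> * ((\<Sum>j\<in>UNIV. \<bar>a $ j\<bar>) * C)" using C by (simp add: sum_nonneg)
    qed (simp_all add: bound)
    finally show ?thesis .
  qed
  show QG_int: "integrable M (\<lambda>x. Q (G a x) \<bullet> g k x)" for a k
    by (rule integrable_const_bound[OF AE_I2[OF QG_bound] QG_meas])
  have W_int: "integrable M (\<lambda>x. W (G a x))" for a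
  proof -
    have "compact (cball (0::'v) ((\<Sum>j\<in>UNIV. \<bar>a $ j\<bar>) * C))" by simp
    then have "bounded (W ` cball 0 ((\<Sum>j\<in>UNIV. \<bar>a $ j\<bar>) * C))"
      by (intro compact_imp_bounded compact_continuous_image continuous_on_subset[OF W_cont]) auto
    then obtain D where "\<And>z. z \<in> cball 0 ((\<Sum>j\<in>UNIV. \<bar>a $ j\<bar>) * C) \<Longrightarrow> norm (W z) \<le> D"
      unfolding bounded_iff by blast
    then have "norm (W (G a x)) \<le> D" for x using G_bound by simp
    then show ?thesis
      by (intro integrable_const_bound[of _ D] AE_I2 measurable_compose[OF G_meas] borel_measurable_continuous_onI W_cont)
  qed
  show "S a \<ge> 0" unfolding S_def by (rule Bochner_Integration.integral_nonneg) (rule W(1))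
  have F_inner: "F b \<bullet> c = (\<integral>x. Q (G b x) \<bullet> G c x \<partial>M)" for b c
  proof -
    have "F b \<bullet> c = (\<Sum>k\<in>UNIV. \<integral>x. c $ k * (Q (G b x) \<bullet> g k x) \<partial>M)"
      by (simp add: F_def inner_vec_def mult.commute)
    also have "\<dots> = (\<integral>x. (\<Sum>k\<in>UNIV. c $ k * (Q (G b x) \<bullet> g k x)) \<partial>M)"
      by (rule Bochner_Integration.integral_sum[symmetric]) (simp add: QG_int)
    also have "\<dots> = (\<integral>x. Q (G b x) \<bullet> G c x \<partial>M)"
      by (simp add: G_def inner_sum_right)
    finally show ?thesis .
  qed
  have "S b - S a = (\<integral>x. W (G b x) - W (G a x) \<partial>M)"
    unfolding S_def by (rule Bochner_Integration.integral_diff[symmetric]) (rule W_int)+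
  also have "\<dots> \<le> (\<integral>x. Q (G b x) \<bullet> G (b - a) x \<partial>M)"
  proof (rule integral_mono)
    show "integrable M (\<lambda>x. W (G b x) - W (G a x))" by (intro Bochner_Integration.integrable_diff W_int)
    have "(\<lambda>x. Q (G b x) \<bullet> G c x) = (\<lambda>x. \<Sum>k\<in>UNIV. c $ k * (Q (G b x) \<bullet> g k x))" for c
      by (simp add: G_def inner_sum_right)
    then show "integrable M (\<lambda>x. Q (G b x) \<bullet> G (b - a) x)" using QG_int by simp
    fix x
    have "G (b - a) x = G b x - G a x"
      by (simp add: G_def scaleR_diff_left sum_subtractf)
    then show "W (G b x) - W (G a x) \<le> Q (G b x) \<bullet> G (b - a) x" using W(2) by simp
  qed
  finally show "S b - S a \<le> F b \<bullet> (b - a)" by (simp add: F_inner)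
  show "continuous_on UNIV F"
    unfolding continuous_on_sequentially
  proof (intro ballI allI impI, elim conjE)
    fix s :: "nat \<Rightarrow> real^'e" and a assume s: "s \<longlonglongrightarrow> a"
    then obtain B where B: "\<And>n. norm (s n) \<le> B"
      using convergent_imp_Bseq[OF convergentI[OF s]] by (auto simp: Bseq_def)
    have "(\<lambda>n. F (s n) $ k) \<longlonglongrightarrow> F a $ k" for k
      unfolding F_def vec_lambda_beta
    proof (rule integral_dominated_convergence[where w = "\<lambda>_. \<bar>L\<bar> * ((\<Sum>j\<in>(UNIV::'e set). B) * C) * C"])
      show "AE x in M. (\<lambda>n. Q (G (s n) x) \<bullet> g k x) \<longlonglongrightarrow> Q (G a x) \<bullet> g k x"
      proof (rule AE_I2)
        fix x
        have "(\<lambda>n. G (s n) x) \<longlonglongrightarrow> G a x"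
          unfolding G_def by (intro tendsto_intros s)
        then have "(\<lambda>n. Q (G (s n) x)) \<longlonglongrightarrow> Q (G a x)"
          using Q(1) by (intro isCont_tendsto_compose[where g = Q]) (simp_all add: continuous_on_eq_continuous_at)
        then show "(\<lambda>n. Q (G (s n) x) \<bullet> g k x) \<longlonglongrightarrow> Q (G a x) \<bullet> g k x" by (intro tendsto_intros)
      qed
      show "AE x in M. norm (Q (G (s n) x) \<bullet> g k x) \<le> \<bar>L\<bar> * ((\<Sum>j\<in>(UNIV::'e set). B) * C) * C" for n
      proof (rule AE_I2, rule order_trans[OF QG_bound])
        have "\<bar>s n $ j\<bar> \<le> B" for j using component_le_norm_cart[of "s n" j] B[of n] by simp
        then have "(\<Sum>j\<in>UNIV. \<bar>s n $ j\<bar>) \<le> (\<Sum>j\<in>(UNIV::'e set). B)" by (intro sum_mono)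
        then show "\<bar>L\<bar> * ((\<Sum>j\<in>UNIV. \<bar>s n $ j\<bar>) * C) * C \<le> \<bar>L\<bar> * ((\<Sum>j\<in>(UNIV::'e set). B) * C) * C"
          using C by (intro mult_right_mono mult_left_mono) auto
      qed
    qed (simp_all add: QG_meas)
    then show "(F \<circ> s) \<longlonglongrightarrow> F a" unfolding comp_def by (rule vec_tendstoI)
  qed
qed

section \<open>Edge elements on a mesh\<close>

text \<open>The curl of an edge function away from the element boundaries, as a simple function. It
  agrees there with \<open>curl (edge_fun \<T> e)\<close>, but is also meaningful on the boundaries.\<close>

definition edge_curl :: "(real^3) set set \<Rightarrow> edge \<Rightarrow> real^3 \<Rightarrow> real^3" where
  "edge_curl \<T> e x = (\<Sum>T \<in> {T\<in>\<T>. edge_verts e \<subseteq> verts T \<and> x \<in> interior T}. \<Sum>b\<in>Basis.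
     cross3 b ((bary_grad T (fst e) \<bullet> b) *\<^sub>R bary_grad T (snd e)
             - (bary_grad T (snd e) \<bullet> b) *\<^sub>R bary_grad T (fst e)))"

definition mesh_skeleton :: "(real^3) set set \<Rightarrow> (real^3) set" where
  "mesh_skeleton \<T> = (\<Union>T\<in>\<T>. frontier T)"

text \<open>Off the skeleton, every element either contains a whole neighbourhood of the point or is disjoint
  from one. So the sum defining the edge function locally runs over a fixed set of elements.\<close>

lemma edge_fun_has_derivative:
  assumes "finite \<T>" "x \<notin> mesh_skeleton \<T>"
  shows "(edge_fun \<T> e has_derivative (\<lambda>h. \<Sum>T \<in> {T\<in>\<T>. edge_verts e \<subseteq> verts T \<and> x \<in> interior T}.
     (bary_grad T (fst e) \<bullet> h) *\<^sub>R bary_grad T (snd e) - (bary_grad T (snd e) \<bullet> h) *\<^sub>R bary_grad T (fst e))) (at x)"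
proof -
  obtain p q where e: "e = (p, q)" by (cases e)
  define U where "U = (\<Inter>T\<in>\<T>. if x \<in> interior T then interior T else - closure T)"
  have "open U" unfolding U_def using assms(1) by (intro open_INT) auto
  have "x \<in> U" using assms(2) by (auto simp: U_def mesh_skeleton_def frontier_def)
  have same: "y \<in> interior T \<longleftrightarrow> x \<in> interior T" if "y \<in> U" "T \<in> \<T>" for y T
  proof -
    have "y \<in> (if x \<in> interior T then interior T else - closure T)" using that by (auto simp: U_def)
    then show ?thesis
      using interior_subset[of T] closure_subset[of T] by (cases "x \<in> interior T") auto
  qed
  let ?\<S> = "{T\<in>\<T>. {p, q} \<subseteq> verts T \<and> x \<in> interior T}"
  have "((\<lambda>y. \<Sum>T \<in> ?\<S>. bary T p y *\<^sub>R bary_grad T q - bary T q y *\<^sub>R bary_grad T p) has_derivative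
      (\<lambda>h. \<Sum>T \<in> ?\<S>. (bary_grad T p \<bullet> h) *\<^sub>R bary_grad T q - (bary_grad T q \<bullet> h) *\<^sub>R bary_grad T p)) (at x)"
    unfolding bary_def by (auto intro!: derivative_eq_intros)
  then show ?thesis
    unfolding e edge_verts.simps fst_conv snd_conv
  proof (rule has_derivative_transform_within_open[OF _ \<open>open U\<close> \<open>x \<in> U\<close>])
    fix y assume "y \<in> U"
    then have "{T\<in>\<T>. {p, q} \<subseteq> verts T \<and> y \<in> interior T} = ?\<S>" using same by blast
    then show "(\<Sum>T \<in> ?\<S>. bary T p y *\<^sub>R bary_grad T q - bary T q y *\<^sub>R bary_grad T p) = edge_fun \<T> (p, q) y"
      by simp
  qed
qed

lemma curl_edge_fun:
  assumes "finite \<T>" "x \<notin> mesh_skeleton \<T>"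
  shows "curl (\<lambda>z. \<Sum>j\<in>J. a j *\<^sub>R edge_fun \<T> (ed j) z) x = (\<Sum>j\<in>J. a j *\<^sub>R edge_curl \<T> (ed j) x)"
proof -
  let ?\<S> = "\<lambda>j. {T\<in>\<T>. edge_verts (ed j) \<subseteq> verts T \<and> x \<in> interior T}"
  let ?D = "\<lambda>T j h. (bary_grad T (fst (ed j)) \<bullet> h) *\<^sub>R bary_grad T (snd (ed j))
    - (bary_grad T (snd (ed j)) \<bullet> h) *\<^sub>R bary_grad T (fst (ed j))"
  have "((\<lambda>z. \<Sum>j\<in>J. a j *\<^sub>R edge_fun \<T> (ed j) z) has_derivative
      (\<lambda>h. \<Sum>j\<in>J. a j *\<^sub>R (\<Sum>T\<in>?\<S> j. ?D T j h))) (at x)"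
    by (intro has_derivative_sum has_derivative_scaleR_right edge_fun_has_derivative assms)
  then have "frechet_derivative (\<lambda>z. \<Sum>j\<in>J. a j *\<^sub>R edge_fun \<T> (ed j) z) (at x)
      = (\<lambda>h. \<Sum>j\<in>J. a j *\<^sub>R (\<Sum>T\<in>?\<S> j. ?D T j h))"
    by (rule frechet_derivative_at[symmetric])
  then have "curl (\<lambda>z. \<Sum>j\<in>J. a j *\<^sub>R edge_fun \<T> (ed j) z) x
      = (\<Sum>b\<in>Basis. cross3 b (\<Sum>j\<in>J. a j *\<^sub>R (\<Sum>T\<in>?\<S> j. ?D T j b)))"
    by (simp add: curl_def partial_def)
  also have "\<dots> = (\<Sum>b\<in>Basis. \<Sum>j\<in>J. a j *\<^sub>R (\<Sum>T\<in>?\<S> j. cross3 b (?D T j b)))"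
  proof -
    have lin: "linear (cross3 b)" for b
      by (rule linearI) (simp_all add: cross_add_right cross_mult_right)
    show ?thesis by (simp add: linear_sum[OF lin] linear_cmul[OF lin])
  qed
  also have "\<dots> = (\<Sum>j\<in>J. a j *\<^sub>R edge_curl \<T> (ed j) x)"
    unfolding edge_curl_def
    by (subst sum.swap) (simp add: scaleR_sum_right[symmetric] sum.swap[of _ Basis])
  finally show ?thesis .
qed

lemma negligible_mesh_skeleton:
  assumes "tetrahedral_mesh \<Omega> \<Omega>C \<T>"
  shows "negligible (mesh_skeleton \<T>)"
  unfolding mesh_skeleton_def
proof (rule negligible_Union)
  show "finite (frontier ` \<T>)"
    using assms by (simp add: tetrahedral_mesh_def triangulation_def)
  fix F assume "F \<in> frontier ` \<T>"
  then obtain T where "T \<in> \<T>" "F = frontier T" by blast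
  moreover from this have "convex T"
    using assms convex_simplex unfolding tetrahedral_mesh_def by blast
  ultimately show "negligible F" using negligible_convex_frontier by blast
qed

lemma edge_curl_measurable_bounded:
  assumes "finite \<T>"
  shows "edge_curl \<T> e \<in> borel_measurable borel" "\<exists>C. \<forall>x. norm (edge_curl \<T> e x) \<le> C"
proof -
  let ?c = "\<lambda>T. \<Sum>b\<in>Basis. cross3 b ((bary_grad T (fst e) \<bullet> b) *\<^sub>R bary_grad T (snd e)
             - (bary_grad T (snd e) \<bullet> b) *\<^sub>R bary_grad T (fst e))"
  let ?\<S> = "{T\<in>\<T>. edge_verts e \<subseteq> verts T}"
  have eq: "edge_curl \<T> e x = (\<Sum>T\<in>?\<S>. indicator (interior T) x *\<^sub>R ?c T)" for x
    unfolding edge_curl_def using assms by (intro sum.mono_neutral_cong_left) auto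
  have "(\<lambda>x. \<Sum>T\<in>?\<S>. indicator (interior T) x *\<^sub>R ?c T) \<in> borel_measurable borel"
    by (intro borel_measurable_sum borel_measurable_scaleR borel_measurable_indicator) auto
  then show "edge_curl \<T> e \<in> borel_measurable borel" by (simp add: eq[abs_def])
  have "norm (edge_curl \<T> e x) \<le> (\<Sum>T\<in>?\<S>. norm (?c T))" for x
    unfolding eq by (rule order_trans[OF norm_sum sum_mono]) (simp add: indicator_def)
  then show "\<exists>C. \<forall>x. norm (edge_curl \<T> e x) \<le> C" by blast
qed

lemma edge_fun_measurable_bounded:
  assumes "finite \<T>" "bounded \<Omega>"
  shows "edge_fun \<T> e \<in> borel_measurable borel" "\<exists>C. \<forall>x\<in>\<Omega>. norm (edge_fun \<T> e x) \<le> C"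
proof -
  obtain p q where e: "e = (p, q)" by (cases e)
  let ?c = "\<lambda>T x. bary T p x *\<^sub>R bary_grad T q - bary T q x *\<^sub>R bary_grad T p"
  let ?\<S> = "{T\<in>\<T>. {p, q} \<subseteq> verts T}"
  have eq: "edge_fun \<T> e x = (\<Sum>T\<in>?\<S>. indicator (interior T) x *\<^sub>R ?c T x)" for x
    unfolding e edge_fun.simps using assms(1) by (intro sum.mono_neutral_cong_left) auto
  have cont: "continuous_on A (?c T)" for T A
    unfolding bary_def by (intro continuous_intros)
  have "(\<lambda>x. \<Sum>T\<in>?\<S>. indicator (interior T) x *\<^sub>R ?c T x) \<in> borel_measurable borel"
    by (intro borel_measurable_sum borel_measurable_scaleR borel_measurable_indicator
        borel_measurable_continuous_onI cont) auto
  then show "edge_fun \<T> e \<in> borel_measurable borel" by (simp add: eq[abs_def])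
  have "\<exists>D. \<forall>x\<in>\<Omega>. norm (?c T x) \<le> D" for T
  proof -
    have "bounded (?c T ` closure \<Omega>)"
      using assms(2) by (intro compact_imp_bounded compact_continuous_image cont) simp
    then show ?thesis unfolding bounded_iff using closure_subset by blast
  qed
  then obtain D where D: "\<And>T x. x \<in> \<Omega> \<Longrightarrow> norm (?c T x) \<le> D T" by metis
  have "norm (edge_fun \<T> e x) \<le> (\<Sum>T\<in>?\<S>. D T)" if "x \<in> \<Omega>" for x
  proof -
    have "0 \<le> D T" for T using D[OF that, of T] norm_ge_zero order_trans by blast
    then show ?thesis
      unfolding eq by (intro order_trans[OF norm_sum sum_mono]) (simp add: indicator_def D[OF that])
  qed
  then show "\<exists>C. \<forall>x\<in>\<Omega>. norm (edge_fun \<T> e x) \<le> C" by blast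
qed

lemma mass_matrix_symmetric: "transpose (mass_matrix \<Omega> \<sigma> \<phi>) = mass_matrix \<Omega> \<sigma> \<phi>"
  by (simp add: mass_matrix_def transpose_def vec_eq_iff inner_commute)

text \<open>The quadratic form is \<open>\<integral> \<sigma> \<bar>\<Sum> v\<^sub>k \<phi>\<^sub>k\<bar>\<^sup>2\<close>. Boundedness of \<open>\<sigma>\<close> and of the edge functions makes
  the entries genuine integrals.\<close>

lemma mass_matrix_nonneg:
  assumes mesh: "finite \<T>" and \<Omega>: "bounded \<Omega>" "open \<Omega>"
    and \<sigma>: "\<sigma> \<in> borel_measurable borel" "\<And>x. 0 \<le> \<sigma> x" "\<And>x. \<sigma> x \<le> s"
  shows "v \<bullet> (mass_matrix \<Omega> \<sigma> (\<lambda>j. edge_fun \<T> (ed j)) *v v) \<ge> 0"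
proof -
  let ?\<phi> = "\<lambda>j. edge_fun \<T> (ed j)"
  let ?M = "lebesgue_on \<Omega>"
  have meas: "\<Omega> \<in> lmeasurable" using \<Omega> by (simp add: bounded_set_imp_lmeasurable lmeasurable_open)
  interpret finite_measure ?M using meas by (rule finite_measure_lebesgue_on)
  have borel: "f \<in> borel_measurable ?M" if "f \<in> borel_measurable borel" for f :: "real^3 \<Rightarrow> 'c::topological_space"
    using that by (intro measurable_restrict_space1 measurable_completion) simp
  have int: "integrable ?M (\<lambda>\<xi>. \<sigma> \<xi> * (?\<phi> l \<xi> \<bullet> ?\<phi> k \<xi>))" for k l
  proof -
    obtain C D where C: "\<And>x. x \<in> \<Omega> \<Longrightarrow> norm (?\<phi> l x) \<le> C" and D: "\<And>x. x \<in> \<Omega> \<Longrightarrow> norm (?\<phi> k x) \<le> D"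
      using edge_fun_measurable_bounded(2)[OF mesh \<Omega>(1)] by metis
    show ?thesis
    proof (rule integrable_const_bound[of _ "s * (C * D)"])
      show "AE \<xi> in ?M. norm (\<sigma> \<xi> * (?\<phi> l \<xi> \<bullet> ?\<phi> k \<xi>)) \<le> s * (C * D)"
      proof (rule AE_I2)
        fix \<xi> assume "\<xi> \<in> space ?M"
        then have \<xi>: "\<xi> \<in> \<Omega>" by simp
        have "\<bar>?\<phi> l \<xi> \<bullet> ?\<phi> k \<xi>\<bar> \<le> norm (?\<phi> l \<xi>) * norm (?\<phi> k \<xi>)" by (rule Cauchy_Schwarz_ineq2)
        also have "\<dots> \<le> C * D"
          using C[OF \<xi>] D[OF \<xi>] order_trans[OF norm_ge_zero C[OF \<xi>]] by (intro mult_mono) auto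
        finally show "norm (\<sigma> \<xi> * (?\<phi> l \<xi> \<bullet> ?\<phi> k \<xi>)) \<le> s * (C * D)"
          using \<sigma>(2,3)[of \<xi>] order_trans[OF \<sigma>(2,3)] by (simp add: abs_mult mult_mono)
      qed
      show "(\<lambda>\<xi>. \<sigma> \<xi> * (?\<phi> l \<xi> \<bullet> ?\<phi> k \<xi>)) \<in> borel_measurable ?M"
        using edge_fun_measurable_bounded(1)[OF mesh \<Omega>(1)] \<sigma>(1)
        by (intro borel_measurable_times borel_measurable_inner borel) auto
    qed
  qed
  have "v \<bullet> (mass_matrix \<Omega> \<sigma> ?\<phi> *v v)
      = (\<Sum>k\<in>UNIV. \<Sum>l\<in>UNIV. v $ k * v $ l * (\<integral>\<xi>. \<sigma> \<xi> * (?\<phi> l \<xi> \<bullet> ?\<phi> k \<xi>) \<partial>?M))"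
    by (simp add: inner_vec_def[of v] matrix_vector_mult_def mass_matrix_def sum_distrib_left mult_ac)
  also have "\<dots> = (\<integral>\<xi>. (\<Sum>k\<in>UNIV. \<Sum>l\<in>UNIV. v $ k * v $ l * (\<sigma> \<xi> * (?\<phi> l \<xi> \<bullet> ?\<phi> k \<xi>))) \<partial>?M)"
    using int by simp
  also have "\<dots> = (\<integral>\<xi>. \<sigma> \<xi> * ((\<Sum>l\<in>UNIV. v $ l *\<^sub>R ?\<phi> l \<xi>) \<bullet> (\<Sum>k\<in>UNIV. v $ k *\<^sub>R ?\<phi> k \<xi>)) \<partial>?M)"
    by (rule Bochner_Integration.integral_cong)
      (simp_all add: inner_sum_left inner_sum_right sum_distrib_left mult_ac inner_commute)
  also have "\<dots> \<ge> 0"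
    using \<sigma>(2) by (intro Bochner_Integration.integral_nonneg mult_nonneg_nonneg) auto
  finally show ?thesis .
qed

text \<open>The vector \<open>K(a) a\<close> is the gradient of the magnetic energy. The two materials contribute
  separately: multiplying the curls by the indicator of a region reduces each contribution to a functional whose density
  does not depend on position, because both fluxes vanish at 0.\<close>

lemma stiffness_gradient:
  fixes ed :: "'e::finite \<Rightarrow> edge" and \<nu>C :: "real \<Rightarrow> real"
  assumes domain: "mqs_domain \<Omega> \<Omega>C" and \<nu>: "\<nu>I > 0" "admissible_reluctivity \<nu>C m L"
    and mesh: "tetrahedral_mesh \<Omega> \<Omega>C \<T>"
  defines "K \<equiv> curlcurl_matrix \<Omega> (reluctivity \<Omega> \<Omega>C \<nu>C \<nu>I) (\<lambda>j. edge_fun \<T> (ed j))"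
  shows "K a $ k $ l = (\<integral>\<xi>. reluctivity \<Omega> \<Omega>C \<nu>C \<nu>I \<xi> (norm (\<Sum>j\<in>UNIV. a $ j *\<^sub>R edge_curl \<T> (ed j) \<xi>))
      * (edge_curl \<T> (ed l) \<xi> \<bullet> edge_curl \<T> (ed k) \<xi>) \<partial>lebesgue_on \<Omega>)" (is "_ = ?K a k l")
    and "\<exists>S. (\<forall>a. S a \<ge> 0) \<and> (\<forall>a b. S b - S a \<le> (K b *v b) \<bullet> (b - a)) \<and> continuous_on UNIV (\<lambda>b. K b *v b)"
proof -
  let ?M = "lebesgue_on \<Omega>" and ?\<nu> = "reluctivity \<Omega> \<Omega>C \<nu>C \<nu>I"
  let ?g = "\<lambda>j. edge_curl \<T> (ed j)"
  let ?G = "\<lambda>a x. \<Sum>j\<in>UNIV. (a::real^'e) $ j *\<^sub>R ?g j x"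
  let ?I = "nonconducting \<Omega> \<Omega>C"
  have fin: "finite \<T>" using mesh by (simp add: tetrahedral_mesh_def triangulation_def)
  have \<Omega>: "open \<Omega>" "bounded \<Omega>" and \<Omega>C: "open \<Omega>C"
    using domain by (auto simp: mqs_domain_def bounded_Lipschitz_domain_def)
  have I_open: "open ?I" unfolding nonconducting_def using \<Omega> by (intro open_Diff) auto
  have disj: "?I \<inter> \<Omega>C = {}" unfolding nonconducting_def using closure_subset by blast
  have meas: "\<Omega> \<in> lmeasurable" using \<Omega> by (simp add: bounded_set_imp_lmeasurable lmeasurable_open)
  have finM: "finite_measure ?M" using meas by (rule finite_measure_lebesgue_on)
  have borel: "f \<in> borel_measurable ?M" if "f \<in> borel_measurable borel" for f :: "real^3 \<Rightarrow> 'c::topological_space"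
    using that by (intro measurable_restrict_space1 measurable_completion) simp
  have skel: "negligible (mesh_skeleton \<T>)" using mesh by (rule negligible_mesh_skeleton)
  have g_borel: "?g j \<in> borel_measurable borel" for j by (rule edge_curl_measurable_bounded(1)[OF fin])
  obtain C0 where C0: "\<And>j x. norm (?g j x) \<le> C0 j"
    using choice[OF allI[OF edge_curl_measurable_bounded(2)[OF fin]], of ed] by blast
  define C where "C = (\<Sum>j\<in>UNIV. C0 j)"
  have C0_nonneg: "0 \<le> C0 j" for j using C0[of j 0] norm_ge_zero order_trans by blast
  have C: "norm (?g j x) \<le> C" for j x
    using C0[of j x] member_le_sum[of j UNIV C0] C0_nonneg by (simp add: C_def)
  have C_nonneg: "0 \<le> C" by (simp add: C_def sum_nonneg C0_nonneg)
  note flux = admissible_reluctivity_flux[OF \<nu>(2)]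
  have G_borel: "?G a \<in> borel_measurable borel" for a
    by (intro borel_measurable_sum borel_measurable_scaleR g_borel) auto
  \<comment> \<open>Away from 0, \<open>\<nu>C\<close> is the continuous function \<open>\<nu>C(\<zeta>) \<zeta>\<close> divided by \<open>\<zeta>\<close>, hence a Borel function.\<close>
  have \<nu>C_borel: "(\<lambda>x. \<nu>C (norm (?G a x))) \<in> borel_measurable borel" for a
  proof -
    have h: "continuous_on UNIV (\<lambda>\<zeta>. \<nu>C (max 0 \<zeta>) * max 0 \<zeta>)"
      by (rule continuous_on_compose2[OF flux(1)]) (auto intro!: continuous_intros)
    have n: "(\<lambda>x. norm (?G a x)) \<in> borel_measurable borel" using G_borel[of a] by measurable
    have "(\<lambda>x. \<nu>C (max 0 (norm (?G a x))) * max 0 (norm (?G a x))) \<in> borel_measurable borel"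
      by (rule measurable_compose[OF n borel_measurable_continuous_onI[OF h]])
    moreover have "{x \<in> space borel. norm (?G a x) = 0} \<in> sets borel"
      using measurable_sets[OF n, of "{0}"] by (simp add: vimage_def)
    ultimately have "(\<lambda>x. if norm (?G a x) = 0 then \<nu>C 0 else
        (\<nu>C (max 0 (norm (?G a x))) * max 0 (norm (?G a x))) / norm (?G a x)) \<in> borel_measurable borel"
      by (intro measurable_If borel_measurable_divide n borel_measurable_const)
    then show ?thesis by (rule measurable_cong[THEN iffD1, rotated]) (auto simp: max_def)
  qed
  have \<nu>_borel: "(\<lambda>x. ?\<nu> x (norm (?G a x)) * (?g l x \<bullet> ?g k x)) \<in> borel_measurable ?M" for a k l
    unfolding reluctivity_def using \<Omega>C I_open
    by (intro borel borel_measurable_times borel_measurable_add \<nu>C_borel borel_measurable_indicator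
        borel_measurable_inner g_borel borel_measurable_const) auto
  have \<nu>_bound: "0 \<le> ?\<nu> x \<zeta>" "?\<nu> x \<zeta> \<le> max (\<nu>C 0) L + \<nu>I" if "\<zeta> \<ge> 0" for x \<zeta>
  proof -
    have "\<nu>C \<zeta> \<le> max (\<nu>C 0) L"
      using flux(4)[OF that] that by (cases "\<zeta> = 0") auto
    then show "0 \<le> ?\<nu> x \<zeta>" "?\<nu> x \<zeta> \<le> max (\<nu>C 0) L + \<nu>I"
      using flux(3)[OF that] \<nu>(1) flux(5) by (auto simp: reluctivity_def indicator_def)
  qed
  have entry_int: "integrable ?M (\<lambda>x. ?\<nu> x (norm (?G a x)) * (?g l x \<bullet> ?g k x))" for a k l
  proof (rule finite_measure.integrable_const_bound[OF finM _ \<nu>_borel])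
    show "AE x in ?M. norm (?\<nu> x (norm (?G a x)) * (?g l x \<bullet> ?g k x)) \<le> (max (\<nu>C 0) L + \<nu>I) * (C * C)"
    proof (rule AE_I2)
      fix x
      have "\<bar>?g l x \<bullet> ?g k x\<bar> \<le> norm (?g l x) * norm (?g k x)" by (rule Cauchy_Schwarz_ineq2)
      also have "\<dots> \<le> C * C" using C C_nonneg by (intro mult_mono) auto
      finally have "\<bar>?g l x \<bullet> ?g k x\<bar> \<le> C * C" .
      then show "norm (?\<nu> x (norm (?G a x)) * (?g l x \<bullet> ?g k x)) \<le> (max (\<nu>C 0) L + \<nu>I) * (C * C)"
        unfolding real_norm_def abs_mult
        using \<nu>_bound[of "norm (?G a x)" x] by (intro mult_mono) auto
    qed
  qed
  show entry: "K a $ k $ l = ?K a k l" for a k l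
  proof -
    have single: "curl (edge_fun \<T> (ed j)) x = ?g j x" if "x \<notin> mesh_skeleton \<T>" for j x
      using curl_edge_fun[OF fin that, where J = "{j}" and a = "\<lambda>_. 1" and ed = ed] by simp
    let ?f = "\<lambda>x. ?\<nu> x (norm (curl (\<lambda>z. \<Sum>j\<in>UNIV. a $ j *\<^sub>R edge_fun \<T> (ed j) z) x))
        * (curl (edge_fun \<T> (ed l)) x \<bullet> curl (edge_fun \<T> (ed k)) x)"
    let ?h = "\<lambda>x. ?\<nu> x (norm (?G a x)) * (?g l x \<bullet> ?g k x)"
    have ae: "AE x in lebesgue. (if x \<in> \<Omega> then ?h x else 0) = (if x \<in> \<Omega> then ?f x else 0)"
    proof (rule AE_I')
      show "mesh_skeleton \<T> \<in> null_sets lebesgue" using skel by (simp add: negligible_iff_null_sets)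
      show "{x \<in> space lebesgue. (if x \<in> \<Omega> then ?h x else 0) \<noteq> (if x \<in> \<Omega> then ?f x else 0)} \<subseteq> mesh_skeleton \<T>"
      proof (intro subsetI, rule ccontr)
        fix x assume *: "x \<in> {x \<in> space lebesgue. (if x \<in> \<Omega> then ?h x else 0) \<noteq> (if x \<in> \<Omega> then ?f x else 0)}"
          and x: "x \<notin> mesh_skeleton \<T>"
        then show False by (simp add: curl_edge_fun[OF fin x] single[OF x] split: if_splits)
      qed
    qed
    have hm: "(\<lambda>x. if x \<in> \<Omega> then ?h x else 0) \<in> borel_measurable lebesgue"
      using \<nu>_borel meas by (subst borel_measurable_if) auto
    have "K a $ k $ l = (\<integral>x. ?f x \<partial>?M)"
      by (simp add: K_def curlcurl_matrix_def)
    also have "\<dots> = (\<integral>x. (if x \<in> \<Omega> then ?f x else 0) \<partial>lebesgue)"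
      by (rule Lebesgue_Measure.integral_restrict_UNIV[symmetric]) (use meas in auto)
    also have "\<dots> = (\<integral>x. (if x \<in> \<Omega> then ?h x else 0) \<partial>lebesgue)"
      by (rule integral_cong_AE[OF borel_measurable_AE[OF hm ae] hm]) (use ae in \<open>auto elim: eventually_mono\<close>)
    also have "\<dots> = ?K a k l"
      by (rule Lebesgue_Measure.integral_restrict_UNIV) (use meas in auto)
    finally show ?thesis .
  qed
  define QC where "QC z = \<nu>C (norm z) *\<^sub>R z" for z :: "real^3"
  define QI where "QI z = \<nu>I *\<^sub>R z" for z :: "real^3"
  obtain WC :: "real^3 \<Rightarrow> real" where WC: "\<And>z. WC z \<ge> 0" "\<And>z z'. WC z' - WC z \<le> QC z' \<bullet> (z' - z)"
    using radial_potential_exists[OF flux(1-3), where 'a = "real^3"] unfolding QC_def by blast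
  define WI where "WI z = \<nu>I / 2 * (z \<bullet> z)" for z :: "real^3"
  have WI: "WI z \<ge> 0" "WI z' - WI z \<le> QI z' \<bullet> (z' - z)" for z z'
  proof -
    show "WI z \<ge> 0" using \<nu>(1) by (simp add: WI_def)
    have "0 \<le> \<nu>I / 2 * ((z' - z) \<bullet> (z' - z))" using \<nu>(1) by simp
    then show "WI z' - WI z \<le> QI z' \<bullet> (z' - z)"
      by (simp add: WI_def QI_def inner_diff_left inner_diff_right inner_commute algebra_simps)
  qed
  have QC: "continuous_on UNIV QC" "norm (QC z) \<le> L * norm z" for z
    unfolding QC_def using continuous_on_radial_flux[OF flux(1,3,4)] by auto
  have QI: "continuous_on UNIV QI" "norm (QI z) \<le> \<nu>I * norm z" for z
    unfolding QI_def using \<nu>(1) by (auto intro!: continuous_intros)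
  define gA where "gA A j x = indicator A x *\<^sub>R ?g j x" for A :: "(real^3) set" and j x
  have gA_meas: "gA A j \<in> borel_measurable ?M" if "open A" for A j
    unfolding gA_def[abs_def] using that by (intro borel borel_measurable_scaleR borel_measurable_indicator g_borel) auto
  have gA_bound: "norm (gA A j x) \<le> C" for A j x
    using C[of j x] C_nonneg by (simp add: gA_def indicator_def)
  have GA: "(\<Sum>j\<in>UNIV. a $ j *\<^sub>R gA A j x) = indicator A x *\<^sub>R ?G a x" for A a x
    by (simp add: gA_def scaleR_sum_right mult.commute)
  note gradC = integral_functional_gradient[where g = "gA \<Omega>C", OF finM gA_meas[OF \<Omega>C] gA_bound QC WC, unfolded GA]
  note gradI = integral_functional_gradient[where g = "gA ?I", OF finM gA_meas[OF I_open] gA_bound QI WI, unfolded GA]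
  define FC where "FC a = (\<chi> k. \<integral>x. QC (indicator \<Omega>C x *\<^sub>R ?G a x) \<bullet> gA \<Omega>C k x \<partial>?M)" for a
  define FI where "FI a = (\<chi> k. \<integral>x. QI (indicator ?I x *\<^sub>R ?G a x) \<bullet> gA ?I k x \<partial>?M)" for a
  define SC where "SC a = (\<integral>x. WC (indicator \<Omega>C x *\<^sub>R ?G a x) \<partial>?M)" for a
  define SI where "SI a = (\<integral>x. WI (indicator ?I x *\<^sub>R ?G a x) \<partial>?M)" for a
  have K_apply: "K b *v b = FC b + FI b" for b
  proof (rule vec_eq_iff[THEN iffD2, rule_format])
    fix k
    have "(K b *v b) $ k = (\<Sum>l\<in>UNIV. \<integral>x. ?\<nu> x (norm (?G b x)) * (?g l x \<bullet> ?g k x) * b $ l \<partial>?M)"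
      by (simp add: matrix_vector_mult_def entry)
    also have "\<dots> = (\<integral>x. (\<Sum>l\<in>UNIV. ?\<nu> x (norm (?G b x)) * (?g l x \<bullet> ?g k x) * b $ l) \<partial>?M)"
      by (rule Bochner_Integration.integral_sum[symmetric]) (simp add: entry_int)
    also have "\<dots> = (\<integral>x. QC (indicator \<Omega>C x *\<^sub>R ?G b x) \<bullet> gA \<Omega>C k x + QI (indicator ?I x *\<^sub>R ?G b x) \<bullet> gA ?I k x \<partial>?M)"
    proof (rule Bochner_Integration.integral_cong[OF refl])
      fix x
      have "(\<Sum>l\<in>UNIV. ?\<nu> x (norm (?G b x)) * (?g l x \<bullet> ?g k x) * b $ l) = ?\<nu> x (norm (?G b x)) * (?G b x \<bullet> ?g k x)"
        by (simp add: inner_sum_left sum_distrib_left sum_distrib_right mult_ac)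
      also have "\<dots> = QC (indicator \<Omega>C x *\<^sub>R ?G b x) \<bullet> gA \<Omega>C k x + QI (indicator ?I x *\<^sub>R ?G b x) \<bullet> gA ?I k x"
        using disj by (auto simp: reluctivity_def QC_def QI_def gA_def indicator_def)
      finally show "(\<Sum>l\<in>UNIV. ?\<nu> x (norm (?G b x)) * (?g l x \<bullet> ?g k x) * b $ l)
        = QC (indicator \<Omega>C x *\<^sub>R ?G b x) \<bullet> gA \<Omega>C k x + QI (indicator ?I x *\<^sub>R ?G b x) \<bullet> gA ?I k x" .
    qed
    also have "\<dots> = (FC b + FI b) $ k"
      unfolding FC_def FI_def vector_add_component vec_lambda_beta
      by (rule Bochner_Integration.integral_add[OF gradC(4) gradI(4)])
    finally show "(K b *v b) $ k = (FC b + FI b) $ k" .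
  qed
  show "\<exists>S. (\<forall>a. S a \<ge> 0) \<and> (\<forall>a b. S b - S a \<le> (K b *v b) \<bullet> (b - a)) \<and> continuous_on UNIV (\<lambda>b. K b *v b)"
  proof (intro exI[of _ "\<lambda>a. SC a + SI a"] conjI allI)
    show "SC a + SI a \<ge> 0" for a using gradC(1)[of a] gradI(1)[of a] unfolding SC_def SI_def by simp
    show "(SC b + SI b) - (SC a + SI a) \<le> (K b *v b) \<bullet> (b - a)" for a b
      using gradC(2)[of b a] gradI(2)[of b a] unfolding K_apply SC_def SI_def FC_def FI_def inner_add_left by linarith
    show "continuous_on UNIV (\<lambda>b. K b *v b)"
      unfolding K_apply FC_def FI_def by (intro continuous_on_add gradC(3) gradI(3))
  qed
qed

section \<open>Block matrices\<close>

lemma sum_UNIV_Plus: "(\<Sum>i\<in>UNIV. f i) = (\<Sum>i\<in>UNIV. f (Inl i)) + (\<Sum>i\<in>UNIV. f (Inr i))"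
  for f :: "'a::finite + 'b::finite \<Rightarrow> 'c::comm_monoid_add"
  by (simp add: UNIV_Plus_UNIV[symmetric] sum.Plus del: UNIV_Plus_UNIV)

lemma forall_sum: "(\<forall>i. P i) \<longleftrightarrow> (\<forall>a. P (Inl a)) \<and> (\<forall>b. P (Inr b))"
  by (metis sum.exhaust)

lemmas block_simps = vec_eq_iff forall_sum block_mat_def block_col_def block_vec_def upper_vec_def
  matrix_matrix_mult_def matrix_vector_mult_def transpose_def mat_def sum_UNIV_Plus

lemma block_mat_mult:
  "block_mat A B C D ** block_mat A' B' C' D' =
   block_mat (A ** A' + B ** C') (A ** B' + B ** D') (C ** A' + D ** C') (C ** B' + D ** D')"
  for A :: "real^'c::finite^'a::finite" and D :: "real^'d::finite^'b::finite"
    and A' :: "real^'e::finite^'c" and D' :: "real^'g::finite^'d"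
  by (simp add: block_simps)

lemma transpose_0: "transpose 0 = (0 :: real^'n^'m)"
  by (simp add: transpose_def vec_eq_iff)

lemma transpose_block_mat:
  "transpose (block_mat A B C D) = block_mat (transpose A) (transpose C) (transpose B) (transpose D)"
  by (simp add: block_simps)

lemma block_mat_add:
  "block_mat A B C D + block_mat A' B' C' D' = block_mat (A + A') (B + B') (C + C') (D + D')"
  by (simp add: block_simps)

lemma block_col_mult: "block_col A B ** P = block_col (A ** P) (B ** P)"
  by (simp add: block_simps)

lemma block_col_mult_transpose:
  "block_col A B ** transpose (block_col A' B') =
   block_mat (A ** transpose A') (A ** transpose B') (B ** transpose A') (B ** transpose B')"
  by (simp add: block_simps)

text \<open>The matrix of the regularized system as mass matrix plus resistive part; the latter is built from
  the factor that also defines the input matrix.\<close>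

lemma E_r_decomposition:
  "E_r M11 X1 X2 Y R = block_mat M11 0 0 0 +
     block_col X1 (transpose Y ** X2) ** matrix_inv R ** transpose (block_col X1 (transpose Y ** X2))"
  by (subst block_col_mult, subst block_col_mult_transpose)
    (simp add: E_r_def block_mat_add matrix_transpose_mul matrix_mul_assoc)

text \<open>The embedding of the reduced states \<open>(a\<^sub>1, a\<^sub>2\<^sub>1)\<close> as coefficient vectors \<open>(a\<^sub>1, Y a\<^sub>2\<^sub>1)\<close> of finite
  element fields.\<close>

definition extension :: "real^'r^'n2 \<Rightarrow> real^('n1::finite + 'r::finite)^('n1 + 'n2::finite)" where
  "extension Y = block_mat (mat 1) 0 0 Y"

lemma upper_vec_extension: "upper_vec (extension Y *v x) = upper_vec x"
  by (simp add: extension_def block_simps sum.delta' if_distrib[of "\<lambda>c. c * _"] cong: if_cong)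

text \<open>The regularized stiffness matrix is the Galerkin restriction of the full one, so the energy
  restricted to reduced states has the gradient \<open>- A\<^sub>r(x) x\<close>.\<close>

lemma A_r_eq_congruence:
  fixes K11 :: "real^'n1 \<Rightarrow> real^'n1^'n1::finite" and K22 :: "real^'n2^'n2::finite" and Y :: "real^'r::finite^'n2"
  shows "A_r K11 K12 K21 K22 Y x = - (transpose (extension Y) ** block_mat (K11 (upper_vec x)) K12 K21 K22 ** extension Y)"
  by (simp add: A_r_def extension_def block_mat_mult transpose_block_mat transpose_0 matrix_mul_assoc)

section \<open>Passivity of the regularized system\<close>

theorem theorem9:
  fixes \<Omega> \<Omega>C :: "(real^3) set"
    and \<sigma>C \<nu>I m\<nu> L\<nu> :: real and \<nu>C :: "real \<Rightarrow> real"
    and R :: "real^'m^'m" and chi \<gamma> :: "'m \<Rightarrow> real^3 \<Rightarrow> real^3"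
    and \<T> :: "(real^3) set set"
    and ed :: "'n1::finite + 'n2::finite \<Rightarrow> edge" and fc :: "'f::finite \<Rightarrow> face"
    and \<phi> :: "'n1 + 'n2 \<Rightarrow> real^3 \<Rightarrow> real^3"
    and C2 :: "real^'n2^'f" and M11 :: "real^'n1^'n1"
    and K :: "real^('n1 + 'n2) \<Rightarrow> real^('n1 + 'n2)^('n1 + 'n2)"
    and K11 :: "real^'n1 \<Rightarrow> real^'n1^'n1" and K12 :: "real^'n2^'n1"
    and K21 :: "real^'n1^'n2" and K22 :: "real^'n2^'n2"
    and X1 :: "real^'m^'n1" and X2 :: "real^'m^'n2"
    and Y :: "real^('r::finite)^'n2"
  assumes domain: "mqs_domain \<Omega> \<Omega>C"
    and conductivity: "\<sigma>C > 0"
    and reluctivity: "\<nu>I > 0" "admissible_reluctivity \<nu>C m\<nu> L\<nu>"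
    and resistance: "spd R"
    and windings: "winding_functions \<Omega> chi" "\<And>j. H1_curl_potential \<Omega> (\<gamma> j) (chi j)"
    and mesh: "tetrahedral_mesh \<Omega> \<Omega>C \<T>" "edge_numbering \<Omega> \<Omega>C \<T> ed" "face_numbering \<T> fc"
    and \<phi>: "\<phi> = (\<lambda>j. edge_fun \<T> (ed j))"
    and C2: "C2 = (\<chi> k j. discrete_curl fc ed $ k $ Inr j)"
    and M11: "M11 = (\<chi> k l. mass_matrix \<Omega> (conductivity \<Omega>C \<sigma>C) \<phi> $ Inl k $ Inl l)"
    and K: "K = curlcurl_matrix \<Omega> (reluctivity \<Omega> \<Omega>C \<nu>C \<nu>I) \<phi>"
    and K11: "K11 = (\<lambda>a1. \<chi> k l. K (block_vec a1 0) $ Inl k $ Inl l)"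
    and K12: "K12 = (\<chi> k l. K 0 $ Inl k $ Inr l)"
    and K21: "K21 = (\<chi> k l. K 0 $ Inr k $ Inl l)"
    and K22: "K22 = (\<chi> k l. K 0 $ Inr k $ Inr l)"
    and X1: "X1 = (\<chi> k j. winding_matrix \<Omega> chi \<phi> $ Inl k $ j)"
    and X2: "X2 = (\<chi> k j. winding_matrix \<Omega> chi \<phi> $ Inr k $ j)"
    and X2_rank: "rank X2 = CARD('m)"
    and Y: "columns_basis Y (range (\<lambda>v. transpose C2 *v v))"
  shows "passive_system (E_r M11 X1 X2 Y R)
           (\<lambda>x. A_r K11 K12 K21 K22 Y x *v x)
           (B_r X1 X2 Y R)
           (mqs_output (B_r X1 X2 Y R) R)"
proof -
  let ?\<nu> = "reluctivity \<Omega> \<Omega>C \<nu>C \<nu>I"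
  let ?g = "\<lambda>j. edge_curl \<T> (ed j)"
  have fin: "finite \<T>" using mesh(1) by (simp add: tetrahedral_mesh_def triangulation_def)
  have \<Omega>: "open \<Omega>" "bounded \<Omega>" and \<Omega>C: "open \<Omega>C"
    using domain by (auto simp: mqs_domain_def bounded_Lipschitz_domain_def)
  note entry = stiffness_gradient(1)[OF domain reluctivity mesh(1), where ed = ed]
  \<comment> \<open>If the interior of an element meets the conductor, all its edges off the boundary of \<open>\<Omega>\<close> are conducting.\<close>
  have no_flux: "?g (Inr j) x = 0" if x: "x \<in> \<Omega>C" for j x
  proof -
    have "edge_verts (ed (Inr j)) \<in> interior_edges \<Omega> \<T> - conducting_edges \<Omega> \<Omega>C \<T>"
      using mesh(2) unfolding edge_numbering_def by (blast dest: bij_betwE)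
    then have *: "\<not> (edge_verts (ed (Inr j)) \<subseteq> verts T \<and> interior T \<subseteq> \<Omega>C)" if "T \<in> \<T>" for T
      using that unfolding conducting_edges_def by blast
    have "interior T \<subseteq> \<Omega>C" if "T \<in> \<T>" "x \<in> interior T" for T
      using that x mesh(1) closure_subset[of \<Omega>C] unfolding tetrahedral_mesh_def nonconducting_def by blast
    with * have "{T \<in> \<T>. edge_verts (ed (Inr j)) \<subseteq> verts T \<and> x \<in> interior T} = {}" by blast
    then show ?thesis unfolding edge_curl_def by (simp only: sum.empty)
  qed
  \<comment> \<open>Outside the conductor the reluctivity does not depend on the field; inside, only conducting edges contribute.\<close>
  have \<nu>_cong: "?\<nu> x (norm (\<Sum>j\<in>UNIV. a $ j *\<^sub>R ?g j x)) * (?g l x \<bullet> ?g k x)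
      = ?\<nu> x (norm (\<Sum>j\<in>UNIV. b $ j *\<^sub>R ?g j x)) * (?g l x \<bullet> ?g k x)"
    if "(\<exists>j. k = Inr j) \<or> (\<exists>j. l = Inr j) \<or> upper_vec a = upper_vec b" for a b k l x
  proof (cases "x \<in> \<Omega>C")
    case True
    then show ?thesis
      using that
    proof (elim disjE)
      assume "upper_vec a = upper_vec b"
      then have "a $ Inl i = b $ Inl i" for i by (simp add: upper_vec_def vec_eq_iff)
      then show ?thesis using True by (simp add: sum_UNIV_Plus no_flux)
    qed (auto simp: no_flux)
  qed (simp add: reluctivity_def)
  have K_cong: "K a $ k $ l = K b $ k $ l"
    if "(\<exists>j. k = Inr j) \<or> (\<exists>j. l = Inr j) \<or> upper_vec a = upper_vec b" for a b k l
    unfolding K \<phi> entry by (rule Bochner_Integration.integral_cong[OF refl \<nu>_cong[OF that]])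
  have upper_block: "upper_vec (block_vec a1 0 :: real^('n1 + 'n2)) = a1" for a1
    by (simp add: upper_vec_def block_vec_def)
  have K_block: "K a = block_mat (K11 (upper_vec a)) K12 K21 K22" for a
  proof -
    have "K a $ Inl k $ Inl l = K11 (upper_vec a) $ k $ l" for k l
      unfolding K11 using K_cong[of "Inl k" "Inl l" a "block_vec (upper_vec a) 0"] upper_block by simp
    moreover have "K a $ Inl k $ Inr l = K12 $ k $ l" for k l
      unfolding K12 using K_cong[of "Inl k" "Inr l" a 0] by simp
    moreover have "K a $ Inr k $ Inl l = K21 $ k $ l" for k l
      unfolding K21 using K_cong[of "Inr k" "Inl l" a 0] by simp
    moreover have "K a $ Inr k $ Inr l = K22 $ k $ l" for k l
      unfolding K22 using K_cong[of "Inr k" "Inr l" a 0] by simp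
    ultimately show ?thesis
      by (simp add: vec_eq_iff forall_sum block_mat_def block_vec_def)
  qed
  let ?T = "extension Y :: real^('n1 + 'r)^('n1 + 'n2)"
  obtain S where S: "\<And>a. S a \<ge> 0" "\<And>a b. S b - S a \<le> (K b *v b) \<bullet> (b - a)"
    and K_cont: "continuous_on UNIV (\<lambda>b. K b *v b)"
    using stiffness_gradient(2)[OF domain reluctivity mesh(1), where ed = ed]
    unfolding K[unfolded \<phi>, symmetric] by blast
  define F where "F x = transpose ?T *v (K (?T *v x) *v (?T *v x))" for x
  have A_r: "A_r K11 K12 K21 K22 Y x *v x = - F x" for x
  proof -
    have "A_r K11 K12 K21 K22 Y x = - (transpose ?T ** K (?T *v x) ** ?T)"
      by (simp add: A_r_eq_congruence K_block upper_vec_extension)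
    moreover have "(- M) *v x = - (M *v x)" for M :: "real^('n1 + 'r)^('n1 + 'r)"
      by (simp add: matrix_vector_mult_def vec_eq_iff sum_negf)
    ultimately show ?thesis
      by (simp add: F_def matrix_vector_mul_assoc matrix_mul_assoc)
  qed
  have F_cont: "continuous_on UNIV F"
  proof -
    have "continuous_on UNIV (\<lambda>x. K (?T *v x) *v (?T *v x))"
      by (rule continuous_on_compose2[OF K_cont]) (auto intro: linear_continuous_on_compose)
    then show ?thesis
      unfolding F_def[abs_def] by (rule linear_continuous_on_compose[OF _ matrix_vector_mul_linear])
  qed
  have S_grad: "S (?T *v b) - S (?T *v a) \<le> F b \<bullet> (b - a)" for a b
    using S(2)[of "?T *v b" "?T *v a"]
    by (simp add: F_def matrix_vector_mult_diff_distrib[symmetric] inner_matrix_vector_mult)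
  define D :: "real^('n1 + 'r)^('n1 + 'r)" where "D = block_mat M11 0 0 0"
  have mass_nonneg: "v \<bullet> (mass_matrix \<Omega> (conductivity \<Omega>C \<sigma>C) \<phi> *v v) \<ge> 0" for v
    unfolding \<phi>
  proof (rule mass_matrix_nonneg[OF fin \<Omega>(2,1)])
    show "conductivity \<Omega>C \<sigma>C \<in> borel_measurable borel"
      unfolding conductivity_def[abs_def] using \<Omega>C by (intro borel_measurable_times) auto
    show "0 \<le> conductivity \<Omega>C \<sigma>C x" "conductivity \<Omega>C \<sigma>C x \<le> \<sigma>C" for x
      using conductivity by (auto simp: conductivity_def indicator_def)
  qed
  have D_nonneg: "v \<bullet> (D *v v) \<ge> 0" for v
  proof -
    have "v \<bullet> (D *v v) = block_vec (upper_vec v) 0 \<bullet> (mass_matrix \<Omega> (conductivity \<Omega>C \<sigma>C) \<phi> *v block_vec (upper_vec v) 0)"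
      by (simp add: D_def M11 inner_vec_def sum_UNIV_Plus block_mat_def block_vec_def upper_vec_def matrix_vector_mult_def)
    then show ?thesis using mass_nonneg by simp
  qed
  have D_sym: "transpose D = D"
  proof -
    have "transpose M11 = M11"
      using mass_matrix_symmetric[of \<Omega> "conductivity \<Omega>C \<sigma>C" \<phi>] by (simp add: M11 transpose_def vec_eq_iff)
    then show ?thesis by (simp add: D_def transpose_block_mat transpose_0)
  qed
  have "passive_system (E_r M11 X1 X2 Y R) (\<lambda>x. - F x) (B_r X1 X2 Y R) (mqs_output (B_r X1 X2 Y R) R)"
    by (rule monotone_gradient_system_passive[OF resistance D_sym D_nonneg
          E_r_decomposition[of M11 X1 X2 Y R, folded D_def] B_r_def F_cont S(1) S_grad])
  then show ?thesis by (simp only: A_r)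
qed

end
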